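(* Let $0<s<1$, $\nu=\frac{1-s^2}{2s}$, $\alpha=\frac{1+s^2}{4s}$, and let $n\ge0$ be an integer. The reproducing kernel of the reproducing kernel Hilbert space $\mathcal{X}_{n,s}(\mathbb{C})$ is given, for $z,w\in\mathbb{C}$, by $$K^s_n(z,w)=\left(\frac{1-s^2}{2\pi s}\right)\frac{(-1)^n}{n!\,\nu^n}\,e^{\nu z\overline{w}-\alpha(z^2+\overline{w}^2)}\,H^\nu_{n,n}(z-w,\overline{z}-\overline{w}).$$
   Context: $d\lambda$ is Lebesgue measure on $\mathbb{C}\equiv\mathbb{R}^2$; $\partial_z,\partial_{\overline z}$ are the Wirtinger derivatives. Throughout $0<s<1$, $\nu=\frac{1-s^2}{2s}$, $\alpha=\frac{1+s^2}{4s}$. Put $\omega_s(z)=e^{\alpha(z^2+\overline{z}^2)-\nu|z|^2}$. Let $\Delta_\nu=-\partial_z\partial_{\overline z}+\nu\overline{z}\,\partial_{\overline z}$, and let $\mathcal{F}^{2,\nu}_n(\mathbb{C})=\{F\in L^2(\mathbb{C},e^{-\nu|z|^2}d\lambda):\Delta_\nu F=n\nu F\}$ (such eigenfunctions are smooth by ellipticity). Then $\mathcal{X}_{n,s}(\mathbb{C})=\{z\mapsto e^{-\alpha z^2}F(z):F\in\mathcal{F}^{2,\nu}_n(\mathbb{C})\}$, a subspace of $L^2(\mathbb{C},\omega_s\,d\lambda)$ with its inner product $\langle f,g\rangle=\int_{\mathbb{C}}f\,\overline{g}\,\omega_s\,d\lambda$. The reproducing kernel convention is: $K^s_n(\cdot,w)\in\mathcal{X}_{n,s}(\mathbb{C})$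 and $f(w)=\langle f,K^s_n(\cdot,w)\rangle$ for all $f\in\mathcal{X}_{n,s}(\mathbb{C})$, $w\in\mathbb{C}$. The complex Hermite polynomials are $H^\nu_{m,n}(z,\overline{z})=(-1)^{m+n}e^{\nu|z|^2}\partial_{\overline z}^m\partial_z^n\left(e^{-\nu|z|^2}\right)$; $H^\nu_{n,n}(z-w,\overline z-\overline w)$ is the polynomial $H^\nu_{n,n}$ evaluated at the point $z-w$. *)

theory Defs
  imports "HOL-Analysis.Analysis"
begin

definition partial_x :: "(complex \<Rightarrow> complex) \<Rightarrow> complex \<Rightarrow> complex"
  where "partial_x F z = frechet_derivative F (at z) 1"

definition partial_y :: "(complex \<Rightarrow> complex) \<Rightarrow> complex \<Rightarrow> complex"
  where "partial_y F z = frechet_derivative F (at z) \<i>"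

text \<open>Real differentiability: \<open>F\<close> is a map of \<open>\<real>\<^sup>2\<close>.\<close>

primrec k_smooth :: "nat \<Rightarrow> (complex \<Rightarrow> complex) \<Rightarrow> bool" where
  "k_smooth 0 F \<longleftrightarrow> continuous_on UNIV F"
| "k_smooth (Suc k) F \<longleftrightarrow>
     (\<forall>z. F differentiable (at z)) \<and> k_smooth k (partial_x F) \<and> k_smooth k (partial_y F)"

definition smooth :: "(complex \<Rightarrow> complex) \<Rightarrow> bool"
  where "smooth F \<longleftrightarrow> (\<forall>k. k_smooth k F)"

definition wirtinger :: "(complex \<Rightarrow> complex) \<Rightarrow> complex \<Rightarrow> complex"
  where "wirtinger F z = (partial_x F z - \<i> * partial_y F z) / 2"

definition wirtinger_bar :: "(complex \<Rightarrow> complex) \<Rightarrow> complex \<Rightarrow> complex"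
  where "wirtinger_bar F z = (partial_x F z + \<i> * partial_y F z) / 2"

definition nu :: "real \<Rightarrow> real"
  where "nu s = (1 - s\<^sup>2) / (2 * s)"

definition alpha :: "real \<Rightarrow> real"
  where "alpha s = (1 + s\<^sup>2) / (4 * s)"

definition magnetic_laplacian :: "real \<Rightarrow> (complex \<Rightarrow> complex) \<Rightarrow> complex \<Rightarrow> complex"
  where "magnetic_laplacian \<nu> F z =
    - wirtinger (wirtinger_bar F) z + of_real \<nu> * cnj z * wirtinger_bar F z"

text \<open>The eigenfunctions are smooth by ellipticity, and point evaluation needs the smooth
  representative, so the space consists of functions rather than of classes modulo null sets.\<close>

definition eigen_space :: "real \<Rightarrow> nat \<Rightarrow> (complex \<Rightarrow> complex) set"
  where "eigen_space \<nu> n =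
    {F. smooth F \<and>
        integrable lborel (\<lambda>z. (cmod (F z))\<^sup>2 * exp (- \<nu> * (cmod z)\<^sup>2)) \<and>
        (\<forall>z. magnetic_laplacian \<nu> F z = of_real (real n * \<nu>) * F z)}"

definition X_space :: "nat \<Rightarrow> real \<Rightarrow> (complex \<Rightarrow> complex) set"
  where "X_space n s =
    (\<lambda>F z. exp (- of_real (alpha s) * z\<^sup>2) * F z) ` eigen_space (nu s) n"

text \<open>The exponent is real; the weight is typed as complex to be multiplied with
  complex-valued functions.\<close>

definition weight :: "real \<Rightarrow> complex \<Rightarrow> complex"
  where "weight s z =
    exp (of_real (alpha s) * (z\<^sup>2 + (cnj z)\<^sup>2) - of_real (nu s * (cmod z)\<^sup>2))"

definition weighted_inner ::
    "real \<Rightarrow> (complex \<Rightarrow> complex) \<Rightarrow> (complex \<Rightarrow> complex) \<Rightarrow> complex"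
  where "weighted_inner s f g = (\<integral>z. f z * cnj (g z) * weight s z \<partial>lborel)"

definition is_reproducing_kernel ::
    "('a \<Rightarrow> complex) set \<Rightarrow> (('a \<Rightarrow> complex) \<Rightarrow> ('a \<Rightarrow> complex) \<Rightarrow> complex)
      \<Rightarrow> ('a \<Rightarrow> 'a \<Rightarrow> complex) \<Rightarrow> bool"
  where "is_reproducing_kernel H ip K \<longleftrightarrow>
    (\<forall>w. (\<lambda>z. K z w) \<in> H) \<and> (\<forall>f\<in>H. \<forall>w. f w = ip f (\<lambda>z. K z w))"

definition complex_hermite :: "real \<Rightarrow> nat \<Rightarrow> nat \<Rightarrow> complex \<Rightarrow> complex"
  where "complex_hermite \<nu> m n z =
    (-1) ^ (m + n) * of_real (exp (\<nu> * (cmod z)\<^sup>2)) *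
    (wirtinger_bar ^^ m) ((wirtinger ^^ n) (\<lambda>u. of_real (exp (- \<nu> * (cmod u)\<^sup>2)))) z"

end

theory Submission
  imports Defs "HOL-Probability.Distributions"
begin

text \<open>
  After removing the factor \<open>exp (- \<alpha> z\<^sup>2)\<close>, the claim is that the eigenspace of the magnetic
  Laplacian has reproducing kernel \<open>(\<nu> / \<pi>) exp (\<nu> z w\<^sup>*) L\<^sub>n (\<nu> \<bar>z - w\<bar>\<^sup>2)\<close>, where \<open>w\<^sup>*\<close> is the
  conjugate of \<open>w\<close> and \<open>L\<^sub>n\<close> the Laguerre polynomial. The magnetic translations
  \<open>F \<mapsto> F (z + w) exp (- \<nu> w\<^sup>* z)\<close> preserve the eigenspace, so only \<open>w = 0\<close> matters. The averages
  \<open>a\<close> of \<open>F\<close> and \<open>b\<close> of \<open>z\<^sup>* \<partial>F/\<partial>z\<^sup>*\<close> over the circle of radius \<open>r\<close> satisfy \<open>r a' = 2 b\<close> and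
  \<open>b' = 2 \<nu> r (b - n a)\<close>; this system is singular at 0 and its regular solution is determined by
  \<open>a 0\<close>, so \<open>a = F 0 L\<^sub>n (\<nu> r\<^sup>2)\<close>. Integrating over all circles and using the normalisation of
  \<open>L\<^sub>n\<close> with respect to \<open>exp (- t)\<close> on \<open>[0, \<infinity>)\<close> gives the reproducing property at 0.
\<close>

subsection \<open>Wirtinger derivatives\<close>

text \<open>Every real-linear map of the plane has the form
  \<open>h \<mapsto> a * h + b * cnj h\<close> for exactly one pair \<open>a\<close>,
  \<open>b\<close>. One predicate thus carries real differentiability and both Wirtinger
  derivatives, and calculus rules come in pairs.\<close>

definition has_wirtinger :: "(complex \<Rightarrow> complex) \<Rightarrow> complex \<Rightarrow> complex \<Rightarrow> complex \<Rightarrow> bool"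
  where "has_wirtinger F a b z \<longleftrightarrow> (F has_derivative (\<lambda>h. a * h + b * cnj h)) (at z)"

lemma has_wirtinger_partial:
  assumes "has_wirtinger F a b z"
  shows "F differentiable (at z)" "partial_x F z = a + b" "partial_y F z = \<i> * (a - b)"
proof -
  have "frechet_derivative F (at z) = (\<lambda>h. a * h + b * cnj h)"
    using assms frechet_derivative_at[of F "\<lambda>h. a * h + b * cnj h" z]
    by (simp add: has_wirtinger_def)
  then show "partial_x F z = a + b" "partial_y F z = \<i> * (a - b)"
    by (simp_all add: partial_x_def partial_y_def ring_distribs)
  show "F differentiable (at z)"
    using assms unfolding has_wirtinger_def differentiable_def by blast
qed

lemma has_wirtinger_imp:
  assumes "has_wirtinger F a b z"
  shows "wirtinger F z = a" "wirtinger_bar F z = b"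
  using has_wirtinger_partial[OF assms]
  by (simp_all add: wirtinger_def wirtinger_bar_def ring_distribs)

text \<open>A real-linear map is determined by its values at \<open>1\<close> and
  \<open>\<i>\<close>, which are the two partial derivatives. Writing \<open>h\<close> in this basis
  and regrouping gives the coefficients of \<open>h\<close> and \<open>cnj h\<close>.\<close>

lemma differentiable_has_wirtinger:
  assumes "F differentiable (at z)"
  shows "has_wirtinger F (wirtinger F z) (wirtinger_bar F z) z"
proof -
  have D: "(F has_derivative frechet_derivative F (at z)) (at z)"
    using assms frechet_derivative_works by blast
  then interpret bounded_linear "frechet_derivative F (at z)"
    by (rule has_derivative_bounded_linear)
  have "frechet_derivative F (at z) h = wirtinger F z * h + wirtinger_bar F z * cnj h" for h
  proof -
    have "frechet_derivative F (at z) h = frechet_derivative F (at z) (Re h *\<^sub>R 1 + Im h *\<^sub>R \<i>)"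
      by (rule arg_cong[where f = "frechet_derivative F (at z)"]) (simp add: complex_eq_iff)
    also have "\<dots> = Re h *\<^sub>R partial_x F z + Im h *\<^sub>R partial_y F z"
      unfolding add scaleR by (simp add: partial_x_def partial_y_def)
    also have "\<dots> = wirtinger F z * h + wirtinger_bar F z * cnj h"
      unfolding wirtinger_def wirtinger_bar_def by (simp add: complex_eq_iff field_simps)
    finally show ?thesis .
  qed
  with D show ?thesis
    by (auto simp: has_wirtinger_def elim!: has_derivative_eq_rhs)
qed

lemma has_wirtinger_const: "has_wirtinger (\<lambda>z. c) 0 0 z"
  by (simp add: has_wirtinger_def)

lemma has_wirtinger_ident: "has_wirtinger (\<lambda>z. z) 1 0 z"
  by (simp add: has_wirtinger_def)

lemma has_wirtinger_cnj: "has_wirtinger cnj 0 1 z"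
  unfolding has_wirtinger_def
  by (rule has_derivative_eq_rhs[OF bounded_linear_imp_has_derivative[OF bounded_linear_cnj]]) simp

lemma has_wirtinger_add:
  "has_wirtinger F a b z \<Longrightarrow> has_wirtinger G c d z \<Longrightarrow>
    has_wirtinger (\<lambda>z. F z + G z) (a + c) (b + d) z"
  unfolding has_wirtinger_def
  by (rule has_derivative_eq_rhs, rule has_derivative_add, assumption+) (auto simp: algebra_simps)

lemma has_wirtinger_mult:
  "has_wirtinger F a b z \<Longrightarrow> has_wirtinger G c d z \<Longrightarrow>
    has_wirtinger (\<lambda>z. F z * G z) (a * G z + F z * c) (b * G z + F z * d) z"
  unfolding has_wirtinger_def
  by (rule has_derivative_eq_rhs, rule has_derivative_mult, assumption+) (auto simp: algebra_simps)

text \<open>The outer function is holomorphic, so its derivative is complex linear and does not mix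
  the two coefficients.\<close>

lemma has_wirtinger_comp:
  assumes "has_wirtinger F a b z" "(g has_field_derivative g') (at (F z))"
  shows "has_wirtinger (\<lambda>z. g (F z)) (g' * a) (g' * b) z"
  using has_derivative_compose[OF assms(1)[unfolded has_wirtinger_def]
      assms(2)[unfolded has_field_derivative_def]]
  by (auto simp: has_wirtinger_def algebra_simps elim!: has_derivative_eq_rhs)

lemma has_wirtinger_shift:
  assumes "has_wirtinger F a b (z + w)"
  shows "has_wirtinger (\<lambda>z. F (z + w)) a b z"
proof -
  have "((\<lambda>z. z + w) has_derivative (\<lambda>h. h)) (at z)"
    by (auto intro!: derivative_eq_intros)
  from has_derivative_compose[OF this assms[unfolded has_wirtinger_def]]
  show ?thesis by (simp add: has_wirtinger_def)
qed

lemma has_wirtinger_eq_rhs: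
  "has_wirtinger F a b z \<Longrightarrow> a = a' \<Longrightarrow> b = b' \<Longrightarrow> has_wirtinger F a' b' z"
  by simp

subsection \<open>Closure properties of smooth functions\<close>

text \<open>The Leibniz rule leaves undifferentiated factors beside the partial derivatives. The
  induction for products therefore needs these factors at the lower order too.\<close>

lemma k_smooth_Suc_imp: "k_smooth (Suc k) F \<Longrightarrow> k_smooth k F"
proof (induction k arbitrary: F)
  case 0
  then show ?case
    by (auto simp: continuous_on_eq_continuous_within intro: differentiable_imp_continuous_within)
next
  case (Suc k)
  from Suc.prems have "k_smooth (Suc k) (partial_x F)" "k_smooth (Suc k) (partial_y F)"
    "\<forall>z. F differentiable (at z)"
    unfolding k_smooth.simps(2)[of "Suc k" F] by blast+
  with Suc.IH show ?case by (simp only: k_smooth.simps(2)[of k F]) blast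
qed

lemma partial_add:
  assumes "F differentiable (at z)" "G differentiable (at z)"
  shows "partial_x (\<lambda>z. F z + G z) z = partial_x F z + partial_x G z"
    "partial_y (\<lambda>z. F z + G z) z = partial_y F z + partial_y G z"
  using has_wirtinger_partial[OF differentiable_has_wirtinger[OF assms(1)]]
    has_wirtinger_partial[OF differentiable_has_wirtinger[OF assms(2)]]
    has_wirtinger_partial[OF has_wirtinger_add[OF assms[THEN differentiable_has_wirtinger]]]
  by (simp_all add: ring_distribs)

lemma partial_mult:
  assumes "F differentiable (at z)" "G differentiable (at z)"
  shows "partial_x (\<lambda>z. F z * G z) z = partial_x F z * G z + F z * partial_x G z"
    "partial_y (\<lambda>z. F z * G z) z = partial_y F z * G z + F z * partial_y G z"
  using has_wirtinger_partial[OF differentiable_has_wirtinger[OF assms(1)]]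
    has_wirtinger_partial[OF differentiable_has_wirtinger[OF assms(2)]]
    has_wirtinger_partial[OF has_wirtinger_mult[OF assms[THEN differentiable_has_wirtinger]]]
  by (simp_all add: ring_distribs)

lemma partial_shift:
  assumes "F differentiable (at (z + w))"
  shows "partial_x (\<lambda>z. F (z + w)) z = partial_x F (z + w)"
    "partial_y (\<lambda>z. F (z + w)) z = partial_y F (z + w)"
  using has_wirtinger_partial[OF differentiable_has_wirtinger[OF assms]]
    has_wirtinger_partial[OF has_wirtinger_shift[OF assms[THEN differentiable_has_wirtinger]]]
  by simp_all

lemma k_smooth_add: "k_smooth k F \<Longrightarrow> k_smooth k G \<Longrightarrow> k_smooth k (\<lambda>z. F z + G z)"
proof (induction k arbitrary: F G)
  case (Suc k)
  then have "partial_x (\<lambda>z. F z + G z) = (\<lambda>z. partial_x F z + partial_x G z)"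
    "partial_y (\<lambda>z. F z + G z) = (\<lambda>z. partial_y F z + partial_y G z)"
    by (auto simp: partial_add)
  with Suc show ?case by simp
qed (simp add: continuous_on_add)

lemma k_smooth_mult: "k_smooth k F \<Longrightarrow> k_smooth k G \<Longrightarrow> k_smooth k (\<lambda>z. F z * G z)"
proof (induction k arbitrary: F G)
  case (Suc k)
  then have "partial_x (\<lambda>z. F z * G z) = (\<lambda>z. partial_x F z * G z + F z * partial_x G z)"
    "partial_y (\<lambda>z. F z * G z) = (\<lambda>z. partial_y F z * G z + F z * partial_y G z)"
    by (auto simp: partial_mult)
  moreover have "k_smooth k F" "k_smooth k G"
    using Suc.prems k_smooth_Suc_imp by blast+
  moreover have "(\<lambda>z. F z * G z) differentiable (at z)" for z
    using Suc.prems by (intro differentiable_mult) simp_all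
  ultimately show ?case
    using Suc.IH Suc.prems by (simp add: k_smooth_add)
qed (simp add: continuous_on_mult)

lemma k_smooth_shift: "k_smooth k F \<Longrightarrow> k_smooth k (\<lambda>z. F (z + w))"
proof (induction k arbitrary: F)
  case 0
  then show ?case
    using continuous_on_compose2[of UNIV F UNIV "\<lambda>z. z + w"]
    by (simp add: continuous_on_add)
next
  case (Suc k)
  have D: "F differentiable (at z)" for z using Suc.prems by simp
  have "partial_x (\<lambda>z. F (z + w)) = (\<lambda>z. partial_x F (z + w))"
    "partial_y (\<lambda>z. F (z + w)) = (\<lambda>z. partial_y F (z + w))"
    using partial_shift[OF D] by auto
  moreover have "(\<lambda>z. F (z + w)) differentiable (at z)" for z
    by (rule has_wirtinger_partial(1)[OF has_wirtinger_shift[OF differentiable_has_wirtinger[OF D]]])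
  ultimately show ?case using Suc by simp
qed

lemma k_smooth_const: "k_smooth k (\<lambda>z. c)"
proof (induction k arbitrary: c)
  case (Suc k)
  have "partial_x (\<lambda>z. c) = (\<lambda>z. 0)" "partial_y (\<lambda>z. c) = (\<lambda>z. 0)"
    using has_wirtinger_partial[OF has_wirtinger_const[of c]] by auto
  then show ?case using Suc[of 0] by simp
qed simp

lemma smooth_add: "smooth F \<Longrightarrow> smooth G \<Longrightarrow> smooth (\<lambda>z. F z + G z)"
  and smooth_mult: "smooth F \<Longrightarrow> smooth G \<Longrightarrow> smooth (\<lambda>z. F z * G z)"
  and smooth_shift: "smooth F \<Longrightarrow> smooth (\<lambda>z. F (z + w))"
  and smooth_const: "smooth (\<lambda>z. c)"
  unfolding smooth_def
  by (blast intro: k_smooth_add k_smooth_mult k_smooth_shift k_smooth_const)+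

lemma smooth_differentiable: "smooth F \<Longrightarrow> F differentiable (at z)"
  unfolding smooth_def by (metis k_smooth.simps(2))

lemma smooth_continuous: "smooth F \<Longrightarrow> continuous_on UNIV F"
  unfolding smooth_def by (metis k_smooth.simps(1))

lemma smooth_partial:
  assumes "smooth F"
  shows "smooth (partial_x F)" "smooth (partial_y F)"
  using assms unfolding smooth_def by (metis k_smooth.simps(2))+

lemma smooth_wirtinger_bar:
  assumes "smooth F"
  shows "smooth (wirtinger_bar F)"
proof -
  have "smooth (\<lambda>z. (partial_x F z + \<i> * partial_y F z) * (1 / 2))"
    by (intro smooth_add smooth_mult smooth_const smooth_partial assms)
  moreover have "wirtinger_bar F = (\<lambda>z. (partial_x F z + \<i> * partial_y F z) * (1 / 2))"
    by (auto simp: wirtinger_bar_def)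
  ultimately show ?thesis by (simp only:)
qed

lemma smooth_ident: "smooth (\<lambda>z. z)"
proof -
  have "partial_x (\<lambda>z. z) = (\<lambda>z. 1)" "partial_y (\<lambda>z. z) = (\<lambda>z. \<i>)"
    "(\<lambda>z. z) differentiable (at z)" for z :: complex
    using has_wirtinger_partial[OF has_wirtinger_ident] by auto
  then have "k_smooth k (\<lambda>z. z)" for k
    by (cases k) (auto simp: k_smooth_const)
  then show ?thesis by (simp add: smooth_def)
qed

lemma smooth_cnj: "smooth cnj"
proof -
  have "partial_x cnj = (\<lambda>z. 1)" "partial_y cnj = (\<lambda>z. - \<i>)"
    "cnj differentiable (at z)" for z :: complex
    using has_wirtinger_partial[OF has_wirtinger_cnj] by auto
  then have "k_smooth k cnj" for k
    by (cases k) (auto simp: k_smooth_const continuous_on_cnj[OF continuous_on_id])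
  then show ?thesis by (simp add: smooth_def)
qed

lemma has_wirtinger_exp: "has_wirtinger (\<lambda>z. exp (c * z)) (c * exp (c * z)) 0 z"
proof -
  have "((\<lambda>z. exp (c * z)) has_field_derivative c * exp (c * z)) (at z)"
    by (auto intro!: derivative_eq_intros)
  then show ?thesis
    using has_wirtinger_comp[OF has_wirtinger_ident, of "\<lambda>z. exp (c * z)"] by simp
qed

text \<open>Both partial derivatives are constant multiples of the function itself, which closes the
  induction on the order.\<close>

lemma smooth_exp: "smooth (\<lambda>z. exp (c * z))"
proof -
  have "partial_x (\<lambda>z. exp (c * z)) = (\<lambda>z. c * exp (c * z))"
    "partial_y (\<lambda>z. exp (c * z)) = (\<lambda>z. \<i> * c * exp (c * z))"
    using has_wirtinger_partial[OF has_wirtinger_exp[of c]] by auto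
  then have "k_smooth k (\<lambda>z. exp (c * z))" for k
    using has_wirtinger_partial[OF has_wirtinger_exp[of c]]
    by (induction k) (auto intro!: k_smooth_mult k_smooth_const
        simp: continuous_on_exp continuous_on_mult)
  then show ?thesis by (simp add: smooth_def)
qed

lemma smooth_poly: "smooth F \<Longrightarrow> smooth (\<lambda>z. poly p (F z))"
  by (induction p) (auto intro!: smooth_add smooth_mult smooth_const)

subsection \<open>Magnetic translations\<close>

lemma lborel_integral_shift:
  fixes f :: "complex \<Rightarrow> 'b::{banach, second_countable_topology}"
  assumes "f \<in> borel_measurable borel"
  shows "integrable lborel (\<lambda>z. f (z + w)) \<longleftrightarrow> integrable lborel f"
    and "(\<integral>z. f (z + w) \<partial>lborel) = (\<integral>z. f z \<partial>lborel)"
proof -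
  have eq: "f (z + w) = f (w + z)" for z by (simp add: add.commute)
  have D: "distr lborel lborel ((+) w) = lborel"
    using lborel_distr_plus[of w] by (simp cong: distr_cong)
  show "integrable lborel (\<lambda>z. f (z + w)) \<longleftrightarrow> integrable lborel f"
    unfolding eq using assms integrable_distr_eq[of "(+) w" lborel lborel f] by (simp add: D)
  show "(\<integral>z. f (z + w) \<partial>lborel) = (\<integral>z. f z \<partial>lborel)"
    unfolding eq using assms integral_distr[of "(+) w" lborel lborel f] by (simp add: D)
qed

text \<open>Expanding \<open>cmod (z + w)\<close> squared shows that a magnetic translation changes
  the Gaussian norm only by a constant factor.\<close>

lemma magnetic_translation_exponent:
  "Re (2 * (- of_real \<nu> * cnj w * z)) - \<nu> * (cmod z)\<^sup>2 = \<nu> * (cmod w)\<^sup>2 - \<nu> * (cmod (z + w))\<^sup>2"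
  unfolding cmod_power2 by (simp add: power2_eq_square algebra_simps)

lemma eigen_space_translation:
  assumes F: "F \<in> eigen_space \<nu> n"
  shows "(\<lambda>z. F (z + w) * exp (- of_real \<nu> * cnj w * z)) \<in> eigen_space \<nu> n" (is "?T \<in> _")
proof -
  define c where "c = - of_real \<nu> * cnj w"
  define T where "T = (\<lambda>z. F (z + w) * exp (c * z))"
  let ?G = "wirtinger_bar F"
  have sF: "smooth F" and LF: "integrable lborel (\<lambda>z. (cmod (F z))\<^sup>2 * exp (- \<nu> * (cmod z)\<^sup>2))"
    and eF: "\<And>z. magnetic_laplacian \<nu> F z = of_real (real n * \<nu>) * F z"
    using F by (auto simp: eigen_space_def)
  have sG: "smooth ?G" by (rule smooth_wirtinger_bar[OF sF])
  have [measurable]: "F \<in> borel_measurable borel"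
    by (rule borel_measurable_continuous_onI[OF smooth_continuous[OF sF]])
  have wb: "wirtinger_bar T = (\<lambda>z. ?G (z + w) * exp (c * z))"
    using has_wirtinger_imp(2)[OF has_wirtinger_mult[OF has_wirtinger_shift[OF
          differentiable_has_wirtinger[OF smooth_differentiable[OF sF]]] has_wirtinger_exp]]
    unfolding T_def by (simp add: fun_eq_iff)
  have ww: "wirtinger (wirtinger_bar T) z =
      (wirtinger ?G (z + w) + c * ?G (z + w)) * exp (c * z)" for z
    unfolding wb
    by (rule has_wirtinger_imp(1)[OF has_wirtinger_eq_rhs[OF has_wirtinger_mult[OF
            has_wirtinger_shift[OF differentiable_has_wirtinger[OF smooth_differentiable[OF sG]]]
            has_wirtinger_exp] _ refl]]) (simp add: algebra_simps)
  have eig: "magnetic_laplacian \<nu> T z = of_real (real n * \<nu>) * T z" for z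
  proof -
    \<comment> \<open>The factor \<open>exp (c * z)\<close> is holomorphic, so only the outer
      \<open>wirtinger\<close> sees it and adds \<open>c * ?G (z + w)\<close>. Since
      \<open>- c\<close> is \<open>\<nu>\<close> times \<open>cnj w\<close>, this term turns the
      coefficient \<open>cnj z\<close> into \<open>cnj (z + w)\<close>.\<close>
    have "magnetic_laplacian \<nu> T z = magnetic_laplacian \<nu> F (z + w) * exp (c * z)"
      unfolding magnetic_laplacian_def ww unfolding wb by (simp add: T_def c_def algebra_simps)
    then show ?thesis unfolding eF by (simp add: T_def)
  qed
  have eq: "(cmod (T z))\<^sup>2 * exp (- \<nu> * (cmod z)\<^sup>2) =
      exp (\<nu> * (cmod w)\<^sup>2) * ((cmod (F (z + w)))\<^sup>2 * exp (- \<nu> * (cmod (z + w))\<^sup>2))" for z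
  proof -
    have "(cmod (exp (c * z)))\<^sup>2 * exp (- \<nu> * (cmod z)\<^sup>2) =
        exp (Re (2 * (c * z)) - \<nu> * (cmod z)\<^sup>2)"
      by (simp add: power2_eq_square flip: exp_add)
    also have "\<dots> = exp (\<nu> * (cmod w)\<^sup>2) * exp (- \<nu> * (cmod (z + w))\<^sup>2)"
      unfolding c_def magnetic_translation_exponent by (simp flip: exp_add)
    finally show ?thesis by (simp add: T_def norm_mult power_mult_distrib mult_ac)
  qed
  have "integrable lborel (\<lambda>z. (cmod (T z))\<^sup>2 * exp (- \<nu> * (cmod z)\<^sup>2))"
    unfolding eq
    using LF lborel_integral_shift(1)[of "\<lambda>z. (cmod (F z))\<^sup>2 * exp (- \<nu> * (cmod z)\<^sup>2)" w]
    by (intro integrable_mult_right) auto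
  moreover have "smooth T"
    unfolding T_def by (intro smooth_mult smooth_shift sF smooth_exp)
  ultimately have "T \<in> eigen_space \<nu> n" using eig by (simp add: eigen_space_def)
  then show ?thesis by (simp only: T_def c_def)
qed

lemma eigen_space_cmult:
  assumes "F \<in> eigen_space \<nu> n"
  shows "(\<lambda>z. c * F z) \<in> eigen_space \<nu> n"
proof -
  have sF: "smooth F" using assms by (simp add: eigen_space_def)
  have wb: "wirtinger_bar (\<lambda>z. c * F z) = (\<lambda>z. c * wirtinger_bar F z)"
    using has_wirtinger_imp(2)[OF has_wirtinger_mult[OF has_wirtinger_const
          differentiable_has_wirtinger[OF smooth_differentiable[OF sF]]]]
    by auto
  have ww: "wirtinger (\<lambda>z. c * wirtinger_bar F z) z = c * wirtinger (wirtinger_bar F) z" for z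
    using has_wirtinger_imp(1)[OF has_wirtinger_mult[OF has_wirtinger_const
          differentiable_has_wirtinger[OF smooth_differentiable[OF smooth_wirtinger_bar[OF sF]]]]]
    by auto
  have "magnetic_laplacian \<nu> (\<lambda>z. c * F z) z = c * magnetic_laplacian \<nu> F z" for z
    unfolding magnetic_laplacian_def wb ww by (simp add: algebra_simps)
  then show ?thesis
    using assms by (auto simp: eigen_space_def norm_mult power_mult_distrib mult.assoc
        intro!: smooth_mult smooth_const)
qed

subsection \<open>Laguerre polynomials as radial eigenfunctions\<close>

definition laguerre :: "nat \<Rightarrow> complex poly"
  where "laguerre n = (\<Sum>k\<le>n. monom ((-1) ^ k * of_nat (n choose k) / fact k) k)"

lemma coeff_laguerre: "coeff (laguerre n) k = (-1) ^ k * of_nat (n choose k) / fact k"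
  by (simp add: laguerre_def coeff_sum)

lemma poly_laguerre: "poly (laguerre n) x = (\<Sum>k\<le>n. (-1) ^ k * of_nat (n choose k) / fact k * x ^ k)"
  by (simp add: laguerre_def poly_sum poly_monom)

lemma poly_laguerre_0: "poly (laguerre n) 0 = 1"
  by (simp add: poly_0_coeff_0 coeff_laguerre)

lemma cnj_poly_laguerre: "cnj (poly (laguerre n) x) = poly (laguerre n) (cnj x)"
  by (simp add: poly_laguerre)

text \<open>Laguerre's equation x L'' + (1 - x) L' + n L = 0. Comparing coefficients reduces it to
  the two-term recursion \<open>rec\<close>.\<close>

lemma laguerre_ode:
  "x * poly (pderiv (pderiv (laguerre n))) x + poly (pderiv (laguerre n)) x =
    x * poly (pderiv (laguerre n)) x - of_nat n * poly (laguerre n) x"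
proof -
  let ?L = "laguerre n"
  have rec: "of_nat (Suc k) ^ 2 * coeff ?L (Suc k) = (of_nat k - of_nat n) * coeff ?L k" for k
  proof -
    have "Suc k * (n choose Suc k) = (n - k) * (n choose k)"
      by (simp only: binomial_absorb_comp binomial_absorption)
    then have "of_nat (Suc k * (n choose Suc k)) = (of_nat ((n - k) * (n choose k)) :: complex)"
      by (simp only:)
    then have *: "of_nat (Suc k) * of_nat (n choose Suc k) =
        ((of_nat n - of_nat k) * of_nat (n choose k) :: complex)"
      \<comment> \<open>For \<open>k > n\<close> the subtraction on naturals truncates, but the
        binomial coefficient vanishes and both sides are 0.\<close>
      by (cases "k \<le> n") (simp_all add: of_nat_diff binomial_eq_0 algebra_simps)
    have "of_nat (Suc k) ^ 2 * coeff ?L (Suc k) =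
        - ((-1) ^ k) * (of_nat (Suc k) * of_nat (n choose Suc k)) / fact k"
      by (simp add: coeff_laguerre power2_eq_square divide_simps del: of_nat_Suc)
    also have "\<dots> = (of_nat k - of_nat n) * coeff ?L k"
      unfolding * by (simp add: coeff_laguerre field_simps)
    finally show ?thesis .
  qed
  have "[:0, 1:] * pderiv (pderiv ?L) + pderiv ?L = [:0, 1:] * pderiv ?L - smult (of_nat n) ?L"
  proof (rule poly_eqI)
    show "coeff ([:0, 1:] * pderiv (pderiv ?L) + pderiv ?L) k =
        coeff ([:0, 1:] * pderiv ?L - smult (of_nat n) ?L) k" for k
      using rec[of k]
      by (cases k) (simp_all add: coeff_pderiv power2_eq_square algebra_simps)
  qed
  from arg_cong[OF this, of "\<lambda>p. poly p x"] show ?thesis by simp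
qed

lemma has_wirtinger_poly_radial:
  "has_wirtinger (\<lambda>z. poly p (c * (z * cnj z)))
    (c * cnj z * poly (pderiv p) (c * (z * cnj z))) (c * z * poly (pderiv p) (c * (z * cnj z))) z"
proof -
  have "has_wirtinger (\<lambda>z. c * (z * cnj z)) (c * cnj z) (c * z) z"
    by (rule has_wirtinger_eq_rhs[OF has_wirtinger_mult[OF has_wirtinger_const
            has_wirtinger_mult[OF has_wirtinger_ident has_wirtinger_cnj]]]) simp_all
  from has_wirtinger_comp[OF this poly_DERIV[of p]] show ?thesis
    by (rule has_wirtinger_eq_rhs) simp_all
qed

lemma smooth_poly_radial: "smooth (\<lambda>z. poly p (c * (z * cnj z)))"
  by (intro smooth_poly smooth_mult smooth_const smooth_ident smooth_cnj)

text \<open>On a radial function g(x) with x = \<nu> z \<open>cnj z\<close> the operator acts as -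
  \<nu> (x g'' + g' - x g'). Laguerre's equation makes this n \<nu> g.\<close>

lemma magnetic_laplacian_laguerre:
  "magnetic_laplacian \<nu> (\<lambda>z. poly (laguerre n) (of_real \<nu> * (z * cnj z))) z =
    of_real (real n * \<nu>) * poly (laguerre n) (of_real \<nu> * (z * cnj z))"
proof -
  let ?c = "complex_of_real \<nu>" and ?L = "laguerre n"
  have wb: "wirtinger_bar (\<lambda>z. poly ?L (?c * (z * cnj z))) =
      (\<lambda>z. ?c * z * poly (pderiv ?L) (?c * (z * cnj z)))"
    using has_wirtinger_imp(2)[OF has_wirtinger_poly_radial] by blast
  have ww: "wirtinger (\<lambda>z. ?c * z * poly (pderiv ?L) (?c * (z * cnj z))) z =
      ?c * (poly (pderiv ?L) (?c * (z * cnj z)) +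
        ?c * (z * cnj z) * poly (pderiv (pderiv ?L)) (?c * (z * cnj z)))"
    by (rule has_wirtinger_imp(1)[OF has_wirtinger_eq_rhs[OF has_wirtinger_mult[OF
              has_wirtinger_mult[OF has_wirtinger_const has_wirtinger_ident]
              has_wirtinger_poly_radial] _ refl]]) (simp add: algebra_simps)
  show ?thesis
    unfolding magnetic_laplacian_def wb ww
    using laguerre_ode[of "?c * (z * cnj z)" n] by (simp add: algebra_simps) algebra
qed

subsection \<open>Circle averages of eigenfunctions\<close>

lemma integral_cis: "integral {0..2 * pi} cis = 0"
  and integral_cnj_cis: "integral {0..2 * pi} (\<lambda>t. cnj (cis t)) = 0"
proof -
  have "((\<lambda>t. - \<i> * cis t) has_vector_derivative cis t) (at t within {0..2 * pi})" for t
    unfolding cis_conv_exp has_vector_derivative_complex_iff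
    by (auto intro!: derivative_eq_intros simp: exp_eq_polar Re_exp Im_exp)
  from fundamental_theorem_of_calculus[OF _ this]
  show "integral {0..2 * pi} cis = 0"
    by (auto dest!: integral_unique)
  have "((\<lambda>t. \<i> * cnj (cis t)) has_vector_derivative cnj (cis t)) (at t within {0..2 * pi})" for t
    unfolding cis_conv_exp has_vector_derivative_complex_iff
    by (auto intro!: derivative_eq_intros simp: exp_eq_polar Re_exp Im_exp)
  from fundamental_theorem_of_calculus[OF _ this]
  show "integral {0..2 * pi} (\<lambda>t. cnj (cis t)) = 0"
    by (auto dest!: integral_unique)
qed

text \<open>The energy \<open>\<bar>p\<bar>\<^sup>2 + \<bar>q / r\<bar>\<^sup>2\<close> satisfies a Gronwall inequality: the term singular at
  \<open>r = 0\<close> in its derivative is \<open>- 2 \<bar>q / r\<bar>\<^sup>2 / r \<le> 0\<close>.\<close>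

lemma singular_ode_unique:
  fixes p q :: "real \<Rightarrow> complex"
  assumes p': "\<And>r. r > 0 \<Longrightarrow> (p has_vector_derivative of_real (2 / r) * q r) (at r)"
    and q': "\<And>r. r > 0 \<Longrightarrow>
      (q has_vector_derivative of_real (2 * \<nu> * r) * (q r - of_nat n * p r)) (at r)"
    and p0: "(p \<longlongrightarrow> 0) (at_right 0)" and q0: "((\<lambda>r. q r / of_real r) \<longlongrightarrow> 0) (at_right 0)"
    and \<nu>: "\<nu> > 0" and R: "R > 0"
  shows "p R = 0"
proof -
  define E where "E r = p r \<bullet> p r + (q r \<bullet> q r) / r\<^sup>2" for r
  define E' where "E' r = 2 * (p r \<bullet> (of_real (2 / r) * q r)) +
      2 * (q r \<bullet> (of_real (2 * \<nu> * r) * (q r - of_nat n * p r))) / r\<^sup>2 - 2 * (q r \<bullet> q r) / r ^ 3" for r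
  \<comment> \<open>The constant absorbs three terms: 2 from the product of \<open>p\<close> and
    \<open>q / r\<close>, \<open>2 * \<nu> * n\<close> from the coupling to \<open>p\<close>, and
    \<open>4 * \<nu> * R\<close> from the growth of \<open>q\<close> on radii up to
    \<open>R\<close>.\<close>
  define C where "C = 2 + 2 * \<nu> * n + 4 * \<nu> * R"
  have dE: "(E has_real_derivative E' r) (at r)" if "r > 0" for r
  proof -
    have "((\<lambda>r. p r \<bullet> p r) has_real_derivative 2 * (p r \<bullet> (of_real (2 / r) * q r))) (at r)"
      using has_derivative_inner[OF p'[OF that, unfolded has_vector_derivative_def]
          p'[OF that, unfolded has_vector_derivative_def]]
      unfolding has_field_derivative_def
      by (rule has_derivative_eq_rhs) (auto simp: fun_eq_iff inner_commute algebra_simps)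
    moreover have "((\<lambda>r. q r \<bullet> q r) has_real_derivative
        2 * (q r \<bullet> (of_real (2 * \<nu> * r) * (q r - of_nat n * p r)))) (at r)"
      using has_derivative_inner[OF q'[OF that, unfolded has_vector_derivative_def]
          q'[OF that, unfolded has_vector_derivative_def]]
      unfolding has_field_derivative_def
      by (rule has_derivative_eq_rhs) (auto simp: fun_eq_iff inner_commute algebra_simps)
    ultimately show ?thesis
      unfolding E_def E'_def using that
      by (auto intro!: derivative_eq_intros simp: power2_eq_square power3_eq_cube field_simps)
  qed
  have E'_le: "E' r \<le> C * E r" if "r > 0" "r \<le> R" for r
  proof -
    \<comment> \<open>In terms of \<open>y = q / r\<close> the energy is the plain sum of squares,
      and the singular contribution to \<open>E'\<close> appears as a single nonpositive
      term.\<close>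
    define x y where "x = p r" and "y = q r / of_real r"
    have q: "q r = of_real r * y" using that by (simp add: y_def)
    have "E' r = 4 * (x \<bullet> y) + 4 * \<nu> * r * (y \<bullet> y) - 4 * \<nu> * n * (y \<bullet> x) - 2 * (y \<bullet> y) / r"
      unfolding E'_def q x_def[symmetric] using that
      by (simp add: inner_complex_def power2_eq_square power3_eq_cube field_simps)
    also have "\<dots> \<le> 2 * (x \<bullet> x + y \<bullet> y) + 4 * \<nu> * R * (y \<bullet> y) + 2 * \<nu> * n * (x \<bullet> x + y \<bullet> y)"
    proof -
      have 1: "2 * (x \<bullet> y) \<le> x \<bullet> x + y \<bullet> y"
        using inner_ge_zero[of "x - y"] by (simp add: inner_diff inner_commute)
      have 2: "- (2 * (y \<bullet> x)) \<le> x \<bullet> x + y \<bullet> y"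
        using inner_ge_zero[of "x + y"] by (simp add: inner_add inner_commute)
      have 3: "(2 * \<nu> * n) * (- (2 * (y \<bullet> x))) \<le> (2 * \<nu> * n) * (x \<bullet> x + y \<bullet> y)"
        using \<nu> by (intro mult_left_mono 2) auto
      have 4: "(4 * \<nu> * r) * (y \<bullet> y) \<le> (4 * \<nu> * R) * (y \<bullet> y)"
        using \<nu> that by (intro mult_right_mono mult_left_mono) auto
      have 5: "2 * (y \<bullet> y) / r \<ge> 0" using that by simp
      from 1 3 4 5 show ?thesis by simp
    qed
    also have "\<dots> \<le> C * (x \<bullet> x + y \<bullet> y)"
      using \<nu> R by (simp add: C_def algebra_simps)
    also have "x \<bullet> x + y \<bullet> y = E r"
      unfolding E_def q x_def using that by (simp add: inner_complex_def power2_eq_square field_simps)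
    finally show ?thesis .
  qed
  \<comment> \<open>The integrating factor turns the Gronwall inequality into monotonicity:
    \<open>f\<close> is nonincreasing for positive radii up to \<open>R\<close> and tends to 0 at
    the origin, so \<open>f R\<close> cannot be positive.\<close>
  define f where "f r = exp (- C * r) * E r" for r
  have df: "(f has_real_derivative exp (- C * r) * (E' r - C * E r)) (at r)" if "r > 0" for r
    unfolding f_def using that
    by (auto intro!: derivative_eq_intros dE simp: algebra_simps)
  have mono: "f R \<le> f r" if "0 < r" "r < R" for r
  proof (rule DERIV_nonpos_imp_nonincreasing[of r R f])
    fix x assume "r \<le> x" "x \<le> R"
    then have "x > 0" using that by simp
    moreover have "exp (- C * x) * (E' x - C * E x) \<le> 0"
      using E'_le[OF \<open>x > 0\<close> \<open>x \<le> R\<close>] by (intro mult_nonneg_nonpos) auto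
    ultimately show "\<exists>y. (f has_real_derivative y) (at x) \<and> y \<le> 0"
      using df by blast
  qed (use that in simp)
  have E0: "(E \<longlongrightarrow> (0::complex) \<bullet> 0 + (0::complex) \<bullet> 0) (at_right 0)"
  proof (rule Lim_transform_eventually)
    show "((\<lambda>r. p r \<bullet> p r + (q r / of_real r) \<bullet> (q r / of_real r)) \<longlongrightarrow> (0::complex) \<bullet> 0 + (0::complex) \<bullet> 0) (at_right 0)"
      by (intro tendsto_add tendsto_inner p0 q0)
    show "\<forall>\<^sub>F r in at_right 0. p r \<bullet> p r + (q r / of_real r) \<bullet> (q r / of_real r) = E r"
      by (auto simp: eventually_at_filter E_def inner_complex_def power2_eq_square add_divide_distrib
          intro!: always_eventually)
  qed
  have "(f \<longlongrightarrow> exp (- C * 0) * 0) (at_right 0)"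
    unfolding f_def using E0 by (intro tendsto_intros) auto
  then have "f R \<le> 0"
    by (intro tendsto_lowerbound[of f 0 "at_right 0"])
      (auto simp: eventually_at_right_field intro!: exI[of _ R] R mono)
  then have "E R \<le> 0"
    unfolding f_def by (simp add: mult_le_0_iff)
  moreover have "0 \<le> (q R \<bullet> q R) / R\<^sup>2" by simp
  ultimately have "p R \<bullet> p R \<le> 0"
    unfolding E_def by linarith
  then show ?thesis using inner_ge_zero[of "p R"] by (metis antisym inner_eq_zero_iff)
qed

section \<open>Derivatives of circle averages of smooth functions\<close>

lemma continuous_circle:
  assumes "continuous_on UNIV F"
  shows "continuous_on S (\<lambda>t. F (c * cis t))"
  by (rule continuous_on_compose2[OF assms]) (auto intro!: continuous_intros)

lemma wirtinger_continuous:
  assumes "smooth F"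
  shows "continuous_on UNIV (wirtinger F)" "continuous_on UNIV (wirtinger_bar F)"
proof -
  note [continuous_intros] = smooth_continuous[OF smooth_partial(1)[OF assms]]
    smooth_continuous[OF smooth_partial(2)[OF assms]]
  show "continuous_on UNIV (wirtinger F)" "continuous_on UNIV (wirtinger_bar F)"
    unfolding wirtinger_def[abs_def] wirtinger_bar_def[abs_def]
    by (rule continuous_intros | simp)+
qed

lemma has_vector_derivative_wirtinger:
  assumes "smooth F" "(g has_vector_derivative g') (at t within S)"
  shows "((\<lambda>t. F (g t)) has_vector_derivative
    wirtinger F (g t) * g' + wirtinger_bar F (g t) * cnj g') (at t within S)"
proof -
  have "(F has_derivative (\<lambda>h. wirtinger F (g t) * h + wirtinger_bar F (g t) * cnj h)) (at (g t))"
    using differentiable_has_wirtinger[OF smooth_differentiable[OF assms(1)]]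
    by (simp add: has_wirtinger_def)
  from has_derivative_compose[OF assms(2)[unfolded has_vector_derivative_def] this]
  show ?thesis
    unfolding has_vector_derivative_def
    by (rule has_derivative_eq_rhs) (simp add: fun_eq_iff scaleR_conv_of_real algebra_simps)
qed

text \<open>The tangential derivative of \<open>F\<close> integrates to zero over a circle.\<close>

lemma circle_mean_tangential:
  assumes F: "smooth F"
  shows "integral {0..2 * pi} (\<lambda>t. wirtinger F (c * cis t) * (c * cis t)) =
    integral {0..2 * pi} (\<lambda>t. wirtinger_bar F (c * cis t) * cnj (c * cis t))"
proof -
  let ?W = "\<lambda>t. wirtinger F (c * cis t) * (c * cis t)"
  let ?B = "\<lambda>t. wirtinger_bar F (c * cis t) * cnj (c * cis t)"
  have "((\<lambda>t. c * cis t) has_vector_derivative \<i> * c * cis t) (at t within S)" for t S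
    unfolding cis_conv_exp has_vector_derivative_complex_iff
    by (auto intro!: derivative_eq_intros simp: exp_eq_polar Re_exp Im_exp)
  from has_vector_derivative_wirtinger[OF F this]
  have "((\<lambda>t. F (c * cis t)) has_vector_derivative \<i> * (?W t - ?B t)) (at t within S)" for t S
    by (simp add: algebra_simps)
  from fundamental_theorem_of_calculus[OF _ this, of 0 "2 * pi"]
  have "((\<lambda>t. \<i> * (?W t - ?B t)) has_integral 0) {0..2 * pi}" by simp
  moreover have "?W integrable_on {0..2 * pi}" "?B integrable_on {0..2 * pi}"
    by (intro integrable_continuous_interval continuous_on_mult continuous_on_cnj continuous_circle
        wirtinger_continuous F continuous_on_const continuous_on_cis continuous_on_id)+
  ultimately show ?thesis
    by (auto dest!: integral_unique simp: integral_diff)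
qed

text \<open>Differentiation under the integral sign over a compact interval. The formula includes
  \<open>r = 0\<close>, where it gives the regularity at the centre that the singular system
  requires.\<close>

lemma circle_mean_radial:
  assumes F: "smooth F"
  shows "((\<lambda>r. integral {0..2 * pi} (\<lambda>t. F (of_real r * u * cis t))) has_vector_derivative
    integral {0..2 * pi} (\<lambda>t. wirtinger F (of_real r * u * cis t) * (u * cis t) +
      wirtinger_bar F (of_real r * u * cis t) * cnj (u * cis t))) (at r)"
proof -
  let ?D = "\<lambda>r t. wirtinger F (of_real r * u * cis t) * (u * cis t) +
      wirtinger_bar F (of_real r * u * cis t) * cnj (u * cis t)"
  note c = continuous_on_compose2[OF wirtinger_continuous(1)[OF F]]
    continuous_on_compose2[OF wirtinger_continuous(2)[OF F]]
  have "((\<lambda>r. integral (cbox 0 (2 * pi)) (\<lambda>t. F (of_real r * u * cis t))) has_vector_derivative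
      integral (cbox 0 (2 * pi)) (?D r)) (at r within UNIV)"
  proof (rule leibniz_rule_vector_derivative)
    fix r t :: real
    have "((\<lambda>r. of_real r * u * cis t) has_vector_derivative u * cis t) (at r)"
    proof -
      have "((\<lambda>r. of_real r * (u * cis t)) has_vector_derivative of_real 1 * (u * cis t)) (at r)"
        by (intro has_vector_derivative_mult_left has_vector_derivative_of_real DERIV_ident)
      then show ?thesis by (simp add: mult.assoc)
    qed
    from has_vector_derivative_wirtinger[OF F this]
    show "((\<lambda>r. F (of_real r * u * cis t)) has_vector_derivative ?D r t) (at r within UNIV)"
      by simp
  next
    show "(\<lambda>t. F (of_real r * u * cis t)) integrable_on cbox 0 (2 * pi)" for r
      using integrable_continuous_interval[OF continuous_circle[OF smooth_continuous[OF F]]]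
      by simp
  next
    show "continuous_on (UNIV \<times> cbox 0 (2 * pi)) (\<lambda>(r, t). ?D r t)"
      unfolding split_def by (intro continuous_intros c) auto
  qed auto
  then show ?thesis by simp
qed

text \<open>Multiplied by \<open>r\<close>, the radial derivative is the sum of the integrals of z
  dF/dz and \<open>cnj z\<close> dF/d(\<open>cnj z\<close>). These agree by
  \<open>circle_mean_tangential\<close>, so either one may be doubled. The first form is applied to
  the eigenfunction, the second to \<open>cnj z * wirtinger_bar F z\<close>.\<close>

lemma circle_mean_radial_scaled:
  fixes u :: complex
  assumes F: "smooth F" and r: "r > 0"
  shows "((\<lambda>r. integral {0..2 * pi} (\<lambda>t. F (of_real r * u * cis t))) has_vector_derivative
      of_real (2 / r) * integral {0..2 * pi} (\<lambda>t. wirtinger_bar F (of_real r * u * cis t) *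
        cnj (of_real r * u * cis t))) (at r)" (is "(?a has_vector_derivative _ * ?B) _")
    and "((\<lambda>r. integral {0..2 * pi} (\<lambda>t. F (of_real r * u * cis t))) has_vector_derivative
      of_real (2 / r) * integral {0..2 * pi} (\<lambda>t. wirtinger F (of_real r * u * cis t) *
        (of_real r * u * cis t))) (at r)" (is "(_ has_vector_derivative _ * ?W) _")
proof -
  let ?z = "\<lambda>t. of_real r * u * cis t"
  let ?D = "\<lambda>t. wirtinger F (?z t) * (u * cis t) + wirtinger_bar F (?z t) * cnj (u * cis t)"
  have i: "(\<lambda>t. wirtinger F (?z t) * ?z t) integrable_on {0..2 * pi}"
    "(\<lambda>t. wirtinger_bar F (?z t) * cnj (?z t)) integrable_on {0..2 * pi}"
    by (intro integrable_continuous_interval continuous_on_mult continuous_on_cnj continuous_circle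
        wirtinger_continuous F continuous_on_const continuous_on_cis continuous_on_id)+
  have "of_real r * integral {0..2 * pi} ?D = integral {0..2 * pi} (\<lambda>t. of_real r * ?D t)"
    by (simp only: integral_mult_right)
  also have "\<dots> = integral {0..2 * pi} (\<lambda>t. wirtinger F (?z t) * ?z t +
      wirtinger_bar F (?z t) * cnj (?z t))"
    by (simp add: algebra_simps)
  also have "\<dots> = ?W + ?B"
    by (rule integral_add[OF i])
  finally have D: "of_real r * integral {0..2 * pi} ?D = ?W + ?B" .
  have WB: "?W = ?B" by (rule circle_mean_tangential[OF F])
  have B: "integral {0..2 * pi} ?D = of_real (2 / r) * ?B"
    using D[unfolded WB] r by (simp add: field_simps)
  show "(?a has_vector_derivative of_real (2 / r) * ?B) (at r)"
    using circle_mean_radial[OF F, of u r] unfolding B .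
  then show "(?a has_vector_derivative of_real (2 / r) * ?W) (at r)"
    unfolding WB .
qed

lemma has_vector_derivative_poly_square:
  "((\<lambda>r. poly p (of_real (\<nu> * r\<^sup>2))) has_vector_derivative
    of_real (2 * \<nu> * r) * poly (pderiv p) (of_real (\<nu> * r\<^sup>2) :: complex)) (at r)"
proof -
  have "((\<lambda>r. complex_of_real (\<nu> * r\<^sup>2)) has_vector_derivative of_real (2 * \<nu> * r)) (at r)"
    by (intro has_vector_derivative_of_real)
      (auto intro!: derivative_eq_intros simp flip: has_real_derivative_iff_has_vector_derivative)
  from field_vector_diff_chain_at[OF this poly_DERIV[of p]]
  show ?thesis by (simp add: o_def)
qed

text \<open>The circle integrals \<open>a\<close>, \<open>b\<close> and the pair built from the
  Laguerre polynomial solve the same singular linear system. Their differences \<open>p\<close> and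
  \<open>q\<close> have vanishing limits at the origin as required by
  \<open>singular_ode_unique\<close>, hence \<open>p\<close> vanishes.\<close>

proposition circle_mean_eigenfunction:
  assumes F: "smooth F" and eig: "\<And>z. magnetic_laplacian \<nu> F z = of_real (real n * \<nu>) * F z"
    and \<nu>: "\<nu> > 0" and u: "cmod u = 1" and r: "r \<ge> 0"
  shows "integral {0..2 * pi} (\<lambda>t. F (of_real r * u * cis t)) =
    of_real (2 * pi) * F 0 * poly (laguerre n) (of_real (\<nu> * r\<^sup>2))"
proof (cases "r = 0")
  case True
  then show ?thesis by (simp add: poly_laguerre_0 scaleR_conv_of_real)
next
  case False
  with r have R: "r > 0" by simp
  \<comment> \<open>For this function the eigenvalue equation expresses \<open>wirtinger H\<close>
    through \<open>H\<close> and \<open>F\<close> alone, which closes the system.\<close>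
  define H where "H z = cnj z * wirtinger_bar F z" for z
  let ?z = "\<lambda>r t. complex_of_real r * u * cis t"
  define a where "a r = integral {0..2 * pi} (\<lambda>t. F (?z r t))" for r
  define b where "b r = integral {0..2 * pi} (\<lambda>t. H (?z r t))" for r
  \<comment> \<open>The integral over the degenerate circle of radius 0; with
    \<open>poly_laguerre_0\<close> this choice gives \<open>p 0 = 0\<close>.\<close>
  define c where "c = of_real (2 * pi) * F 0"
  let ?L = "laguerre n"
  define p where "p r = a r - c * poly ?L (of_real (\<nu> * r\<^sup>2))" for r
  \<comment> \<open>The subtracted term is \<open>r / 2\<close> times the radial derivative of the
    Laguerre term in \<open>p\<close>, as the first equation of the system demands.\<close>
  define q where "q r = b r - c * (of_real (\<nu> * r\<^sup>2) * poly (pderiv ?L) (of_real (\<nu> * r\<^sup>2)))" for r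
  have G: "smooth (wirtinger_bar F)" by (rule smooth_wirtinger_bar[OF F])
  have H: "smooth H" unfolding H_def[abs_def] by (intro smooth_mult smooth_cnj G)
  have wH: "wirtinger H z = of_real \<nu> * cnj z * (H z - of_nat n * F z)" for z
  proof -
    have "wirtinger H z = cnj z * wirtinger (wirtinger_bar F) z"
      unfolding H_def[abs_def]
      by (rule has_wirtinger_imp(1)[OF has_wirtinger_eq_rhs[OF has_wirtinger_mult[OF
                has_wirtinger_cnj differentiable_has_wirtinger[OF smooth_differentiable[OF G]]]
              _ refl]]) simp
    moreover have "wirtinger (wirtinger_bar F) z = of_real \<nu> * H z - of_real (real n * \<nu>) * F z"
      using eig[of z] by (simp add: magnetic_laplacian_def H_def algebra_simps)
    ultimately show ?thesis by (simp add: algebra_simps)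
  qed
  have a': "(a has_vector_derivative of_real (2 / r) * b r) (at r)" if "r > 0" for r
    using circle_mean_radial_scaled(1)[OF F that, of u]
    unfolding a_def[abs_def] b_def H_def by (simp add: mult_ac)
  have iF: "(\<lambda>t. F (?z r t)) integrable_on {0..2 * pi}"
    and iH: "(\<lambda>t. H (?z r t)) integrable_on {0..2 * pi}" for r
    by (intro integrable_continuous_interval continuous_circle smooth_continuous F H)+
  have b': "(b has_vector_derivative of_real (2 * \<nu> * r) * (b r - of_nat n * a r)) (at r)"
    if "r > 0" for r
  proof -
    have "wirtinger H (?z r t) * ?z r t = of_real (\<nu> * r\<^sup>2) * (H (?z r t) - of_nat n * F (?z r t))" for t
    proof -
      have "cnj (?z r t) * ?z r t = of_real (r\<^sup>2)"
        using complex_norm_square[of "?z r t"] u that by (simp add: norm_mult mult_ac)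
      moreover have "wirtinger H w * w = of_real \<nu> * (cnj w * w) * (H w - of_nat n * F w)" for w
        unfolding wH by (simp add: mult_ac)
      ultimately show ?thesis by (simp only: of_real_mult)
    qed
    then have eq: "integral {0..2 * pi} (\<lambda>t. wirtinger H (?z r t) * ?z r t) =
        of_real (\<nu> * r\<^sup>2) * (b r - of_nat n * a r)"
      unfolding a_def b_def
      by (simp only: integral_mult_right integral_diff[OF iH integrable_on_mult_right[OF iF]])
    have "(b has_vector_derivative of_real (2 / r) * (of_real (\<nu> * r\<^sup>2) * (b r - of_nat n * a r))) (at r)"
      using circle_mean_radial_scaled(2)[OF H that, of u] unfolding eq b_def[abs_def] .
    moreover have "of_real (2 / r) * (of_real (\<nu> * r\<^sup>2) * (b r - of_nat n * a r)) =
        of_real (2 * \<nu> * r) * (b r - of_nat n * a r)"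
      using that by (simp add: power2_eq_square)
    ultimately show ?thesis by simp
  qed
  have "p r = 0"
  proof (rule singular_ode_unique[where q = q, OF _ _ _ _ \<nu> R])
    fix r :: real assume r: "r > 0"
    have "(p has_vector_derivative of_real (2 / r) * b r -
        c * (of_real (2 * \<nu> * r) * poly (pderiv ?L) (of_real (\<nu> * r\<^sup>2)))) (at r)"
      unfolding p_def[abs_def]
      by (intro has_vector_derivative_diff has_vector_derivative_mult_right a' r
          has_vector_derivative_poly_square)
    then show "(p has_vector_derivative of_real (2 / r) * q r) (at r)"
      using r by (simp add: q_def power2_eq_square algebra_simps)
    have "((\<lambda>r. of_real (\<nu> * r\<^sup>2) * poly (pderiv ?L) (of_real (\<nu> * r\<^sup>2))) has_vector_derivative
        of_real (2 * \<nu> * r) * poly (pderiv ([:0, 1:] * pderiv ?L)) (of_real (\<nu> * r\<^sup>2))) (at r)"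
      using has_vector_derivative_poly_square[of "[:0, 1:] * pderiv ?L" \<nu> r] by simp
    then have "(q has_vector_derivative of_real (2 * \<nu> * r) * (b r - of_nat n * a r) -
        c * (of_real (2 * \<nu> * r) * poly (pderiv ([:0, 1:] * pderiv ?L)) (of_real (\<nu> * r\<^sup>2)))) (at r)"
      unfolding q_def[abs_def]
      by (intro has_vector_derivative_diff has_vector_derivative_mult_right b' r)
    \<comment> \<open>Laguerre's equation in the divergence form (x L')' = x L' - n L is the second
      equation of the system for the comparison pair.\<close>
    moreover have ode: "poly (pderiv ([:0, 1:] * pderiv ?L)) x = x * poly (pderiv ?L) x - of_nat n * poly ?L x" for x
      using laguerre_ode[of x n] by (simp add: pderiv_mult pderiv_pCons algebra_simps)
    have "of_real (2 * \<nu> * r) * (b r - of_nat n * a r) -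
        c * (of_real (2 * \<nu> * r) * poly (pderiv ([:0, 1:] * pderiv ?L)) (of_real (\<nu> * r\<^sup>2))) =
        of_real (2 * \<nu> * r) * (q r - of_nat n * p r)"
      unfolding ode p_def q_def by (simp add: algebra_simps)
    ultimately show "(q has_vector_derivative of_real (2 * \<nu> * r) * (q r - of_nat n * p r)) (at r)"
      by (simp only:)
  next
    \<comment> \<open>The derivative at 0 serves only to establish continuity of \<open>p\<close>
      there.\<close>
    have "(p has_vector_derivative (integral {0..2 * pi} (\<lambda>t. wirtinger F (of_real 0 * u * cis t) * (u * cis t) +
      wirtinger_bar F (of_real 0 * u * cis t) * cnj (u * cis t))) -
        c * (of_real (2 * \<nu> * 0) * poly (pderiv ?L) (of_real (\<nu> * 0\<^sup>2)))) (at 0)"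
      unfolding p_def[abs_def] a_def
      by (intro has_vector_derivative_diff has_vector_derivative_mult_right
          has_vector_derivative_poly_square circle_mean_radial F)
    then have "isCont p 0" by (rule has_vector_derivative_continuous)
    moreover have "p 0 = 0"
      by (simp add: p_def a_def c_def poly_laguerre_0 scaleR_conv_of_real)
    ultimately show "(p \<longlongrightarrow> 0) (at_right 0)"
      by (auto simp: isCont_def intro: tendsto_within_subset)
  next
    \<comment> \<open>At the centre the integrand is linear in \<open>cis t\<close> and its
      conjugate, so the derivative of \<open>b\<close> at 0 vanishes. Together with
      \<open>b 0 = 0\<close>, which the factor \<open>cnj z\<close> in \<open>H\<close> provides,
      this makes \<open>b r\<close> of order o(r).\<close>
    let ?D = "\<lambda>t. wirtinger H 0 * u * cis t + wirtinger_bar H 0 * cnj u * cnj (cis t)"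
    have "integral {0..2 * pi} ?D = 0"
      by (subst integral_add)
        (auto simp: integral_cis integral_cnj_cis intro!: integrable_continuous_interval continuous_intros)
    then have "(b has_vector_derivative 0) (at 0)"
      using circle_mean_radial[OF H, of u 0] unfolding b_def[abs_def] by (simp add: mult_ac)
    moreover have "b 0 = 0" by (simp add: b_def H_def)
    ultimately have "((\<lambda>r. norm (b r / of_real r)) \<longlongrightarrow> 0) (at 0)"
      by (simp add: has_vector_derivative_def has_derivative_at norm_divide)
    then have "((\<lambda>r. b r / of_real r) \<longlongrightarrow> 0) (at 0)"
      by (rule tendsto_norm_zero_cancel)
    then have "((\<lambda>r. b r / of_real r) \<longlongrightarrow> 0) (at_right 0)"
      by (rule tendsto_within_subset) auto
    moreover have "((\<lambda>r. c * (of_real (\<nu> * r) * poly (pderiv ?L) (of_real (\<nu> * r\<^sup>2)))) \<longlongrightarrow>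
        c * (of_real (\<nu> * 0) * poly (pderiv ?L) (of_real (\<nu> * 0\<^sup>2)))) (at_right 0)"
      by (intro tendsto_intros)
    ultimately have "((\<lambda>r. b r / of_real r - c * (of_real (\<nu> * r) * poly (pderiv ?L) (of_real (\<nu> * r\<^sup>2)))) \<longlongrightarrow> 0 - 0) (at_right 0)"
      by (intro tendsto_diff) simp_all
    then show "((\<lambda>r. q r / of_real r) \<longlongrightarrow> 0) (at_right 0)"
      unfolding diff_zero
      by (rule Lim_transform_eventually)
        (auto simp: q_def eventually_at_filter power2_eq_square field_simps intro!: always_eventually)
  qed
  then show ?thesis by (simp add: p_def a_def c_def)
qed

subsection \<open>Lebesgue measure on the complex plane\<close>

text \<open>Both measures agree on boxes. This gives access to Fubini's theorem in the real and
  imaginary coordinates.\<close>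

lemma lborel_eq_distr_Complex:
  "lborel = distr (lborel \<Otimes>\<^sub>M lborel) borel (\<lambda>(x, y). Complex x y)"
proof (rule lborel_eqI)
  have [measurable]: "(\<lambda>(x, y). Complex x y) \<in> borel_measurable (lborel \<Otimes>\<^sub>M lborel)"
    unfolding Complex_eq split_def by measurable
  fix l u :: complex assume le': "\<And>b. b \<in> Basis \<Longrightarrow> l \<bullet> b \<le> u \<bullet> b"
  have le: "Re l \<le> Re u" "Im l \<le> Im u"
    using le'[of 1] le'[of \<i>] by (simp_all add: Basis_complex_def)
  have "(\<lambda>(x, y). Complex x y) -` box l u = {Re l<..<Re u} \<times> {Im l<..<Im u}"
    by (auto simp: box_def Basis_complex_def)
  then have "emeasure (distr (lborel \<Otimes>\<^sub>M lborel) borel (\<lambda>(x, y). Complex x y)) (box l u) =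
      emeasure (lborel \<Otimes>\<^sub>M lborel) ({Re l<..<Re u} \<times> {Im l<..<Im u})"
    by (subst emeasure_distr) (auto simp: space_pair_measure)
  also have "\<dots> = ennreal ((Re u - Re l) * (Im u - Im l))"
    using le by (subst lborel.emeasure_pair_measure_Times) (auto simp: ennreal_mult)
  finally show "emeasure (distr (lborel \<Otimes>\<^sub>M lborel) borel (\<lambda>(x, y). Complex x y)) (box l u) =
      ennreal (\<Prod>b\<in>Basis. (u - l) \<bullet> b)"
    by (simp add: Basis_complex_def)
qed simp

lemma measurable_Complex [measurable]:
  assumes [measurable]: "f \<in> borel_measurable M" "g \<in> borel_measurable M"
  shows "(\<lambda>x. Complex (f x) (g x)) \<in> borel_measurable M"
  unfolding Complex_eq by measurable

lemma nn_integral_lborel_complex: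
  assumes [measurable]: "f \<in> borel_measurable borel"
  shows "(\<integral>\<^sup>+z. f z \<partial>lborel) = (\<integral>\<^sup>+x. \<integral>\<^sup>+y. f (Complex x y) \<partial>lborel \<partial>lborel)"
    and "(\<integral>\<^sup>+z. f z \<partial>lborel) = (\<integral>\<^sup>+y. \<integral>\<^sup>+x. f (Complex x y) \<partial>lborel \<partial>lborel)"
proof -
  have "(\<integral>\<^sup>+z. f z \<partial>lborel) = (\<integral>\<^sup>+p. f (Complex (fst p) (snd p)) \<partial>(lborel \<Otimes>\<^sub>M lborel))"
    by (subst lborel_eq_distr_Complex, subst nn_integral_distr) (auto simp: split_def)
  also have "\<dots> = (\<integral>\<^sup>+x. \<integral>\<^sup>+y. f (Complex x y) \<partial>lborel \<partial>lborel)"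
    by (subst lborel.nn_integral_fst[symmetric]) auto
  finally show 1: "(\<integral>\<^sup>+z. f z \<partial>lborel) = (\<integral>\<^sup>+x. \<integral>\<^sup>+y. f (Complex x y) \<partial>lborel \<partial>lborel)" .
  show "(\<integral>\<^sup>+z. f z \<partial>lborel) = (\<integral>\<^sup>+y. \<integral>\<^sup>+x. f (Complex x y) \<partial>lborel \<partial>lborel)"
    unfolding 1 by (rule lborel_pair.Fubini'[symmetric]) measurable
qed

section \<open>Invariance of Lebesgue measure under shears and rotations\<close>

lemma nn_integral_translate:
  fixes t :: real
  assumes "f \<in> borel_measurable borel"
  shows "(\<integral>\<^sup>+x. f (x + t) \<partial>lborel) = (\<integral>\<^sup>+x. f x \<partial>lborel)"
  using nn_integral_real_affine[OF assms, of 1 t] by (simp add: add.commute)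

text \<open>With one coordinate fixed, a shear is a translation in the other. The order of iterated
  integration is chosen so that the translated coordinate is innermost.\<close>

lemma nn_integral_shear:
  assumes [measurable]: "f \<in> borel_measurable borel"
  shows "(\<integral>\<^sup>+z. f (Complex (Re z + a * Im z) (Im z)) \<partial>lborel) = (\<integral>\<^sup>+z. f z \<partial>lborel)"
    and "(\<integral>\<^sup>+z. f (Complex (Re z) (Im z + a * Re z)) \<partial>lborel) = (\<integral>\<^sup>+z. f z \<partial>lborel)"
proof -
  have "(\<integral>\<^sup>+x. f (Complex (x + a * y) y) \<partial>lborel) = (\<integral>\<^sup>+x. f (Complex x y) \<partial>lborel)"
    "(\<integral>\<^sup>+y. f (Complex x (y + a * x)) \<partial>lborel) = (\<integral>\<^sup>+y. f (Complex x y) \<partial>lborel)" for x y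
    using nn_integral_translate[of "\<lambda>x. f (Complex x y)" "a * y"]
      nn_integral_translate[of "\<lambda>y. f (Complex x y)" "a * x"] by simp_all
  then show "(\<integral>\<^sup>+z. f (Complex (Re z + a * Im z) (Im z)) \<partial>lborel) = (\<integral>\<^sup>+z. f z \<partial>lborel)"
    "(\<integral>\<^sup>+z. f (Complex (Re z) (Im z + a * Re z)) \<partial>lborel) = (\<integral>\<^sup>+z. f z \<partial>lborel)"
    by (subst (1 2) nn_integral_lborel_complex(2), simp_all)
      (subst (1 2) nn_integral_lborel_complex(1), simp_all)
qed

text \<open>A rotation by an angle that is not a multiple of \<open>\<pi>\<close> is a product of three shears.\<close>

lemma nn_integral_rotate_aux:
  assumes c: "cmod c = 1" "Im c \<noteq> 0" and [measurable]: "f \<in> borel_measurable borel"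
  shows "(\<integral>\<^sup>+z. f (c * z) \<partial>lborel) = (\<integral>\<^sup>+z. f z \<partial>lborel)"
proof -
  \<comment> \<open>For \<open>c = cis \<theta>\<close> these are sin \<theta> and - tan (\<theta> /
    2), the coefficients of the shears in the factorisation \<open>X (Y (X z))\<close>.\<close>
  define b t where "b = Im c" and "t = (Re c - 1) / Im c"
  define X Y where "X z = Complex (Re z + t * Im z) (Im z)" and "Y z = Complex (Re z) (Im z + b * Re z)"
    for z
  have [measurable]: "X \<in> borel_measurable borel" "Y \<in> borel_measurable borel"
    unfolding X_def[abs_def] Y_def[abs_def] by measurable
  have tb: "t * b = Re c - 1" using c by (simp add: t_def b_def)
  have sq: "Re c * Re c + b * b = 1"
    using c(1) cmod_power2[of c] by (simp add: b_def power2_eq_square)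
  have "t * (Re c + 1) * b = (t * b) * (Re c + 1)" by simp
  also have "\<dots> = - b * b"
    unfolding tb using sq by (simp add: algebra_simps)
  finally have "(t * (Re c + 1) + b) * b = 0" by (simp add: algebra_simps)
  then have t: "t * (Re c + 1) = - b" using c by (simp add: b_def)
  have "c * z = X (Y (X z))" for z
  proof (rule complex_eqI)
    have "Re (X (Y (X z))) = (1 + t * b) * Re z + t * ((1 + t * b) + 1) * Im z"
      by (simp add: X_def Y_def algebra_simps)
    then show "Re (c * z) = Re (X (Y (X z)))"
      unfolding tb using t by (simp add: b_def)
    have "Im (X (Y (X z))) = b * Re z + (1 + t * b) * Im z"
      by (simp add: X_def Y_def algebra_simps)
    then show "Im (c * z) = Im (X (Y (X z)))"
      unfolding tb by (simp add: b_def)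
  qed
  then have "(\<integral>\<^sup>+z. f (c * z) \<partial>lborel) = (\<integral>\<^sup>+z. f (X (Y (X z))) \<partial>lborel)" by simp
  also have "\<dots> = (\<integral>\<^sup>+z. f (X (Y z)) \<partial>lborel)"
    using nn_integral_shear(1)[of "\<lambda>z. f (X (Y z))" t] by (simp add: X_def)
  also have "\<dots> = (\<integral>\<^sup>+z. f (X z) \<partial>lborel)"
    using nn_integral_shear(2)[of "\<lambda>z. f (X z)" b] by (simp add: Y_def)
  also have "\<dots> = (\<integral>\<^sup>+z. f z \<partial>lborel)"
    using nn_integral_shear(1)[of f t] by (simp add: X_def)
  finally show ?thesis .
qed

lemma nn_integral_rotate:
  assumes c: "cmod c = 1" and [measurable]: "f \<in> borel_measurable borel"
  shows "(\<integral>\<^sup>+z. f (c * z) \<partial>lborel) = (\<integral>\<^sup>+z. f z \<partial>lborel)"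
proof (cases "Im c = 0")
  case False
  then show ?thesis using nn_integral_rotate_aux c by simp
next
  case True
  \<comment> \<open>Here \<open>c\<close> is 1 or -1. It factors as \<open>\<i> * d\<close>, and
    both factors have nonzero imaginary part.\<close>
  define d where "d = - \<i> * c"
  have d: "cmod d = 1" "Im d \<noteq> 0"
    using c True by (auto simp: d_def norm_mult cmod_def)
  have "(\<integral>\<^sup>+z. f (c * z) \<partial>lborel) = (\<integral>\<^sup>+z. f (\<i> * (d * z)) \<partial>lborel)"
    by (simp add: d_def flip: mult.assoc)
  also have "\<dots> = (\<integral>\<^sup>+z. f (\<i> * z) \<partial>lborel)"
    by (rule nn_integral_rotate_aux[OF d, of "\<lambda>z. f (\<i> * z)"]) measurable
  also have "\<dots> = (\<integral>\<^sup>+z. f z \<partial>lborel)"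
    by (rule nn_integral_rotate_aux) auto
  finally show ?thesis .
qed

section \<open>Integrals of radial functions and averaging over rotations\<close>

lemma distr_lborel_rotate:
  fixes c :: complex
  assumes c: "cmod c = 1"
  shows "distr lborel lborel ((*) c) = lborel"
proof (rule measure_eqI)
  fix A assume "A \<in> sets (distr lborel lborel ((*) c))"
  then have [measurable]: "A \<in> sets borel" by simp
  have "emeasure (distr lborel lborel ((*) c)) A = (\<integral>\<^sup>+z. indicator A (c * z) \<partial>lborel)"
    by (subst nn_integral_indicator[symmetric], simp, subst nn_integral_distr) auto
  also have "\<dots> = emeasure lborel A"
    using nn_integral_rotate[OF c, of "indicator A"] by simp
  finally show "emeasure (distr lborel lborel ((*) c)) A = emeasure lborel A" .
qed simp

lemma lborel_integral_rotate:
  fixes f :: "complex \<Rightarrow> 'b::{banach, second_countable_topology}"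
  assumes "cmod c = 1" "f \<in> borel_measurable borel"
  shows "integrable lborel (\<lambda>z. f (c * z)) \<longleftrightarrow> integrable lborel f"
    and "(\<integral>z. f (c * z) \<partial>lborel) = (\<integral>z. f z \<partial>lborel)"
  using assms integrable_distr_eq[of "(*) c" lborel lborel f] integral_distr[of "(*) c" lborel lborel f]
  by (simp_all add: distr_lborel_rotate)

text \<open>This takes the place of polar coordinates: the disc where the function is at most
  \<open>a \<ge> 0\<close> has area \<open>pi * a / \<nu>\<close>, linear in \<open>a\<close>, so
  the image measure has constant density. Half-lines generate the Borel sets and are stable under
  intersection.\<close>

lemma distr_lborel_norm_square:
  assumes \<nu>: "\<nu> > 0"
  shows "distr lborel borel (\<lambda>z::complex. \<nu> * (cmod z)\<^sup>2) =
    density lborel (\<lambda>t. ennreal (pi / \<nu>) * indicator {0..} t)"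
proof (rule measure_eqI_generator_eq)
  let ?E = "range (\<lambda>a::real. {..a})" and ?D = "distr lborel borel (\<lambda>z::complex. \<nu> * (cmod z)\<^sup>2)"
  show "Int_stable ?E"
    by (auto simp: Int_stable_def min_def[symmetric] Int_commute)
  show "?E \<subseteq> Pow UNIV" by simp
  have em: "emeasure ?D {..a} = ennreal (pi / \<nu> * max a 0)" for a
  proof -
    have "emeasure ?D {..a} = emeasure lborel {z::complex. \<nu> * (cmod z)\<^sup>2 \<le> a}"
      by (subst emeasure_distr) (auto simp: vimage_def)
    also have "\<dots> = ennreal (pi / \<nu> * max a 0)"
    proof (cases "a \<ge> 0")
      case True
      have "{z::complex. \<nu> * (cmod z)\<^sup>2 \<le> a} = cball 0 (sqrt (a / \<nu>))"
        using \<nu> by (auto simp: real_le_rsqrt field_simps dest!: sqrt_ge_absD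
            intro: real_le_rsqrt)
          (smt (verit) norm_ge_zero pos_le_divide_eq power_mono real_sqrt_pow2 divide_nonneg_pos mult.commute True)
      then show ?thesis
        using True \<nu> by (simp add: emeasure_cball unit_ball_vol_2)
    next
      case False
      then have "{z::complex. \<nu> * (cmod z)\<^sup>2 \<le> a} = {}"
        using \<nu> by (auto simp: not_le intro: less_le_trans)
      with False show ?thesis by simp
    qed
    finally show ?thesis .
  qed
  show "emeasure ?D X = emeasure (density lborel (\<lambda>t. ennreal (pi / \<nu>) * indicator {0..} t)) X"
    if "X \<in> ?E" for X
  proof -
    from that obtain a where X: "X = {..a}" by auto
    have "emeasure (density lborel (\<lambda>t. ennreal (pi / \<nu>) * indicator {0..} t)) {..a} =
        (\<integral>\<^sup>+t. ennreal (pi / \<nu>) * indicator {0..a} t \<partial>lborel)"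
      by (subst emeasure_density) (auto intro!: nn_integral_cong split: split_indicator)
    also have "\<dots> = ennreal (pi / \<nu> * max a 0)"
      using \<nu> by (cases "a \<ge> 0") (simp_all add: nn_integral_cmult_indicator max_def flip: ennreal_mult')
    finally show ?thesis unfolding X em by simp
  qed
  show "sets ?D = sigma_sets UNIV ?E"
    "sets (density lborel (\<lambda>t. ennreal (pi / \<nu>) * indicator {0..} t)) = sigma_sets UNIV ?E"
    by (simp_all add: borel_eq_atMost)
  show "range (\<lambda>i::nat. {..real i}) \<subseteq> ?E" "(\<Union>i::nat. {..real i}) = UNIV"
    by (auto simp: real_arch_simple)
  show "emeasure ?D {..real i} \<noteq> \<infinity>" for i
    unfolding em by simp
qed

lemma has_bochner_integral_radial:
  fixes g :: "real \<Rightarrow> complex"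
  assumes \<nu>: "\<nu> > 0" and [measurable]: "g \<in> borel_measurable borel"
    and g: "has_bochner_integral lborel (\<lambda>t. indicator {0..} t *\<^sub>R g t) I"
  shows "has_bochner_integral lborel (\<lambda>z::complex. g (\<nu> * (cmod z)\<^sup>2)) (of_real (pi / \<nu>) * I)"
proof -
  let ?d = "\<lambda>t. pi / \<nu> * indicator {0..} t"
  have d: "(\<lambda>t. ennreal (pi / \<nu>) * indicator {0..} t) = (\<lambda>t. ennreal (?d t))"
    using \<nu> by (auto simp: fun_eq_iff split: split_indicator)
  have eq: "(\<lambda>t. ?d t *\<^sub>R g t) = (\<lambda>t. (pi / \<nu>) *\<^sub>R (indicator {0..} t *\<^sub>R g t))"
    by (auto simp: fun_eq_iff)
  have "has_bochner_integral lborel (\<lambda>t. ?d t *\<^sub>R g t) ((pi / \<nu>) *\<^sub>R I)"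
    unfolding eq by (rule has_bochner_integral_scaleR_right) (use g in simp)
  then have "has_bochner_integral (distr lborel borel (\<lambda>z::complex. \<nu> * (cmod z)\<^sup>2)) g ((pi / \<nu>) *\<^sub>R I)"
    unfolding distr_lborel_norm_square[OF \<nu>] d
    using \<nu> by (intro has_bochner_integral_density) auto
  then show ?thesis
    unfolding has_bochner_integral_iff
    by (subst (asm) integrable_distr_eq, simp, simp, subst (asm) integral_distr)
      (simp_all add: scaleR_conv_of_real)
qed

text \<open>Fubini over the angle and the plane. As \<open>\<phi>\<close> and Lebesgue measure are
  rotation invariant, the integral over the plane is the same for every angle.\<close>

lemma integral_circle_average:
  fixes F \<phi> :: "complex \<Rightarrow> complex"
  assumes F: "continuous_on UNIV F" and \<phi>: "continuous_on UNIV \<phi>"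
    and rot: "\<And>c z. cmod c = 1 \<Longrightarrow> \<phi> (c * z) = \<phi> z"
    and int: "integrable lborel (\<lambda>z. F z * \<phi> z)"
  shows "(\<integral>z. integral {0..2 * pi} (\<lambda>t. F (z * cis t)) * \<phi> z \<partial>lborel) =
    of_real (2 * pi) * (\<integral>z. F z * \<phi> z \<partial>lborel)"
proof -
  \<comment> \<open>The indicator extends the angular integral to the whole line, so that Fubini for
    a pair of Lebesgue measures applies.\<close>
  define g where "g t z = indicator {0..2 * pi} t *\<^sub>R (F (z * cis t) * \<phi> z)" for t :: real and z
  have [measurable]: "F \<in> borel_measurable borel" "\<phi> \<in> borel_measurable borel"
      "cis \<in> borel_measurable borel"
    using F \<phi> by (auto intro!: borel_measurable_continuous_onI continuous_on_cis continuous_on_id)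
  have rotF: "F (z * cis t) * \<phi> z = F (cis t * z) * \<phi> (cis t * z)" for t z
    using rot[of "cis t" z] by (simp add: mult.commute)
  have int_rot: "integrable lborel (\<lambda>z. F (z * cis t) * \<phi> z)" for t
    unfolding rotF using int by (subst lborel_integral_rotate(1)[of _ "\<lambda>z. F z * \<phi> z"]) auto
  have int_g: "(\<integral>z. g t z \<partial>lborel) = indicator {0..2 * pi} t *\<^sub>R (\<integral>z. F z * \<phi> z \<partial>lborel)" for t
    unfolding g_def rotF by (simp add: lborel_integral_rotate(2)[of _ "\<lambda>z. F z * \<phi> z"])
  have norm_g: "(\<integral>z. norm (g t z) \<partial>lborel) = indicator {0..2 * pi} t *\<^sub>R (\<integral>z. norm (F z * \<phi> z) \<partial>lborel)" for t
    unfolding g_def rotF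
    using lborel_integral_rotate(2)[of "cis t" "\<lambda>z. norm (F z * \<phi> z)"] by simp
  have "integrable (lborel \<Otimes>\<^sub>M lborel) (\<lambda>(t, z). g t z)"
  proof (rule lborel_pair.Fubini_integrable)
    show "(\<lambda>(t, z). g t z) \<in> borel_measurable (lborel \<Otimes>\<^sub>M lborel)"
      unfolding g_def split_def by measurable
    show "integrable lborel (\<lambda>t. \<integral>z. norm (case (t, z) of (t, z) \<Rightarrow> g t z) \<partial>lborel)"
      by (simp add: norm_g)
    show "AE t in lborel. integrable lborel (\<lambda>z. case (t, z) of (t, z) \<Rightarrow> g t z)"
      unfolding g_def by (intro AE_I2) (simp add: int_rot)
  qed
  then have "(\<integral>z. (\<integral>t. g t z \<partial>lborel) \<partial>lborel) = (\<integral>t. (\<integral>z. g t z \<partial>lborel) \<partial>lborel)"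
    by (rule lborel_pair.Fubini_integral)
  also have "\<dots> = of_real (2 * pi) * (\<integral>z. F z * \<phi> z \<partial>lborel)"
    unfolding int_g by (simp add: scaleR_conv_of_real)
  also have "(\<lambda>z. \<integral>t. g t z \<partial>lborel) = (\<lambda>z. integral {0..2 * pi} (\<lambda>t. F (z * cis t)) * \<phi> z)"
  proof
    fix z
    have "set_integrable lborel {0..2 * pi} (\<lambda>t. F (z * cis t))"
      by (intro borel_integrable_atLeastAtMost' continuous_circle F)
    from set_borel_integral_eq_integral(2)[OF this]
    show "(\<integral>t. g t z \<partial>lborel) = integral {0..2 * pi} (\<lambda>t. F (z * cis t)) * \<phi> z"
      unfolding g_def set_lebesgue_integral_def
      by (simp flip: mult_scaleR_left)
  qed
  finally show ?thesis .
qed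

subsection \<open>Normalisation of the Laguerre polynomials\<close>

lemma has_bochner_integral_power_exp:
  "has_bochner_integral lborel (\<lambda>t. indicator {0..} t *\<^sub>R complex_of_real (t ^ k * exp (- t))) (fact k)"
proof -
  have "has_bochner_integral lborel (\<lambda>t::real. t ^ k * exp (- t) * indicator {0..} t) (fact k)"
  proof (rule has_bochner_integral_nn_integral)
    have "(\<integral>\<^sup>+t. ennreal (t ^ k * exp (- t) * indicator {0..} t) \<partial>lborel) =
        (\<integral>\<^sup>+t. ennreal (t ^ k * exp (- t)) * indicator {0..} t \<partial>lborel)"
      by (rule nn_integral_cong) (simp split: split_indicator)
    then show "(\<integral>\<^sup>+t. ennreal (t ^ k * exp (- t) * indicator {0..} t) \<partial>lborel) = ennreal (fact k)"
      using nn_intergal_power_times_exp_Ici[of k] by simp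
  qed (auto split: split_indicator)
  from has_bochner_integral_of_real[OF this, where 'a = complex] show ?thesis
    by (simp add: scaleR_conv_of_real mult_ac)
qed

text \<open>Pascal's rule summed against arbitrary weights. It drives both the alternating sums
  below and the Leibniz rule for iterated \<open>wirtinger_bar\<close>.\<close>

lemma binomial_sum_Suc:
  fixes g :: "nat \<Rightarrow> 'a::comm_ring_1"
  shows "(\<Sum>k\<le>Suc n. of_nat (Suc n choose k) * g k) =
    (\<Sum>k\<le>n. of_nat (n choose k) * g k) + (\<Sum>k\<le>n. of_nat (n choose k) * g (Suc k))"
proof -
  have "(\<Sum>k\<le>Suc n. of_nat (Suc n choose k) * g k) =
      g 0 + (\<Sum>k\<le>n. of_nat (n choose k) * g (Suc k)) + (\<Sum>k\<le>n. of_nat (n choose Suc k) * g (Suc k))"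
    by (subst sum.atMost_Suc_shift) (simp add: algebra_simps sum.distrib)
  moreover have "(\<Sum>k\<le>Suc n. of_nat (n choose k) * g k) =
      g 0 + (\<Sum>k\<le>n. of_nat (n choose Suc k) * g (Suc k))"
    by (subst sum.atMost_Suc_shift) simp
  \<comment> \<open>The surplus top term contains \<open>n choose Suc n\<close>, which is 0.\<close>
  ultimately show ?thesis by (simp add: binomial_eq_0)
qed

lemma alternating_binomial_sum_Suc:
  fixes g :: "nat \<Rightarrow> 'a::comm_ring_1"
  shows "(\<Sum>k\<le>Suc n. (-1) ^ k * of_nat (Suc n choose k) * g k) =
    (\<Sum>k\<le>n. (-1) ^ k * of_nat (n choose k) * g k) - (\<Sum>k\<le>n. (-1) ^ k * of_nat (n choose k) * g (Suc k))"
  using binomial_sum_Suc[of n "\<lambda>k. (-1) ^ k * g k"]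
  by (simp add: sum_negf mult_ac del: sum.atMost_Suc binomial_Suc_Suc)

text \<open>Up to sign this is the n-th forward difference of the polynomial x choose j, and each
  difference lowers j by one. The induction needs the hypothesis at \<open>x\<close> and at
  \<open>Suc x\<close>.\<close>

lemma alternating_binomial_sum:
  "(\<Sum>k\<le>n. (-1) ^ k * of_nat (n choose k) * of_nat ((x + k) choose j)) =
    (if n \<le> j then (-1) ^ n * of_nat (x choose (j - n)) else (0::'a::comm_ring_1))"
proof (induction n arbitrary: x)
  case (Suc n)
  have "(\<Sum>k\<le>Suc n. (-1) ^ k * of_nat (Suc n choose k) * of_nat ((x + k) choose j)) =
      (if n \<le> j then (-1) ^ n * of_nat (x choose (j - n)) else (0::'a)) -
      (if n \<le> j then (-1) ^ n * of_nat (Suc x choose (j - n)) else 0)"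
    unfolding alternating_binomial_sum_Suc Suc.IH[symmetric] by simp
  also have "\<dots> = (if Suc n \<le> j then (-1) ^ Suc n * of_nat (x choose (j - Suc n)) else 0)"
  proof (cases "Suc n \<le> j")
    case True
    then obtain i where "j - n = Suc i" "j - Suc n = i" by (metis Suc_diff_Suc Suc_le_lessD)
    with True show ?thesis by (simp add: algebra_simps)
  next
    case False
    then show ?thesis by (cases "n = j") auto
  qed
  finally show ?case .
qed simp

text \<open>Expanding both factors leaves Gamma integrals. For fixed \<open>j\<close> the sum over
  \<open>k\<close> is an n-th difference of a polynomial of degree \<open>j\<close>, hence 0 for
  \<open>j < n\<close>: the polynomial is orthogonal to lower powers. Only \<open>j = n\<close>
  remains, and it contributes 1.\<close>

lemma has_bochner_integral_laguerre_square:
  "has_bochner_integral lborel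
    (\<lambda>t. indicator {0..} t *\<^sub>R (poly (laguerre n) (of_real t) ^ 2 * of_real (exp (- t)))) 1"
proof -
  define c where "c k = (-1) ^ k * of_nat (n choose k) / (fact k :: complex)" for k
  have "has_bochner_integral lborel
      (\<lambda>t. \<Sum>j\<le>n. \<Sum>k\<le>n. c j * c k * (indicator {0..} t *\<^sub>R complex_of_real (t ^ (j + k) * exp (- t))))
      (\<Sum>j\<le>n. \<Sum>k\<le>n. c j * c k * fact (j + k))"
    by (intro has_bochner_integral_sum has_bochner_integral_mult_right has_bochner_integral_power_exp)
  also have "(\<lambda>t. \<Sum>j\<le>n. \<Sum>k\<le>n. c j * c k * (indicator {0..} t *\<^sub>R complex_of_real (t ^ (j + k) * exp (- t)))) =
      (\<lambda>t. indicator {0..} t *\<^sub>R (poly (laguerre n) (of_real t) ^ 2 * of_real (exp (- t))))"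
    unfolding poly_laguerre c_def[symmetric]
    by (simp add: fun_eq_iff power2_eq_square sum_product power_add scaleR_conv_of_real
        sum_distrib_left sum_distrib_right mult_ac)
  also have "(\<Sum>j\<le>n. \<Sum>k\<le>n. c j * c k * fact (j + k)) = (\<Sum>j\<le>n. if j = n then 1 else 0)"
  proof (intro sum.cong refl)
    fix j assume j: "j \<in> {..n}"
    \<comment> \<open>Splitting off \<open>fact j\<close> turns the Gamma value over
      \<open>fact k\<close> into a binomial coefficient, the form that
      \<open>alternating_binomial_sum\<close> evaluates.\<close>
    have "c k * fact (j + k) = fact j * ((-1) ^ k * of_nat (n choose k) * of_nat ((j + k) choose j))" for k
      by (simp add: c_def binomial_fact)
    then have "(\<Sum>k\<le>n. c k * fact (j + k)) =
        fact j * (if n \<le> j then (-1) ^ n * of_nat (j choose (j - n)) else 0)"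
      by (simp only: sum_distrib_left[symmetric] alternating_binomial_sum)
    then have "(\<Sum>k\<le>n. c j * c k * fact (j + k)) =
        c j * (fact j * (if n \<le> j then (-1) ^ n * of_nat (j choose (j - n)) else 0))"
      by (simp only: mult.assoc sum_distrib_left[symmetric])
    also have "\<dots> = (if j = n then 1 else 0)"
      using j by (auto simp: c_def simp flip: power_mult_distrib)
    finally show "(\<Sum>k\<le>n. c j * c k * fact (j + k)) = (if j = n then 1 else 0)" .
  qed
  finally show ?thesis by simp
qed

subsection \<open>The reproducing property\<close>

text \<open>The product is dominated by the sum of the two integrable weighted squares.\<close>

lemma eigen_space_integrable_product:
  assumes "F \<in> eigen_space \<nu> n" "G \<in> eigen_space \<nu> m"
  shows "integrable lborel (\<lambda>z. F z * (G z * of_real (exp (- \<nu> * (cmod z)\<^sup>2))))"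
proof (rule Bochner_Integration.integrable_bound)
  have c: "continuous_on UNIV F" "continuous_on UNIV G"
    using assms by (auto simp: eigen_space_def intro: smooth_continuous)
  have [measurable]: "F \<in> borel_measurable borel" "G \<in> borel_measurable borel"
    using c by (auto intro: borel_measurable_continuous_onI)
  show "integrable lborel (\<lambda>z. (cmod (F z))\<^sup>2 * exp (- \<nu> * (cmod z)\<^sup>2) +
      (cmod (G z))\<^sup>2 * exp (- \<nu> * (cmod z)\<^sup>2))"
    using assms by (intro Bochner_Integration.integrable_add) (simp_all add: eigen_space_def)
  show "(\<lambda>z. F z * (G z * of_real (exp (- \<nu> * (cmod z)\<^sup>2)))) \<in> borel_measurable lborel"
    by measurable
  show "AE z in lborel. norm (F z * (G z * of_real (exp (- \<nu> * (cmod z)\<^sup>2)))) \<le>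
      norm ((cmod (F z))\<^sup>2 * exp (- \<nu> * (cmod z)\<^sup>2) + (cmod (G z))\<^sup>2 * exp (- \<nu> * (cmod z)\<^sup>2))"
  proof (intro AE_I2)
    fix z
    have "cmod (F z) * cmod (G z) \<le> (cmod (F z))\<^sup>2 + (cmod (G z))\<^sup>2"
      using sum_squares_bound[of "cmod (F z)" "cmod (G z)"]
        mult_nonneg_nonneg[OF norm_ge_zero norm_ge_zero, of "F z" "G z"] by linarith
    from mult_right_mono[OF this, of "exp (- \<nu> * (cmod z)\<^sup>2)"]
    show "norm (F z * (G z * of_real (exp (- \<nu> * (cmod z)\<^sup>2)))) \<le>
      norm ((cmod (F z))\<^sup>2 * exp (- \<nu> * (cmod z)\<^sup>2) + (cmod (G z))\<^sup>2 * exp (- \<nu> * (cmod z)\<^sup>2))"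
      by (simp add: norm_mult algebra_simps)
  qed
qed

lemma has_bochner_integral_laguerre_radial:
  assumes \<nu>: "\<nu> > 0"
  shows "has_bochner_integral lborel (\<lambda>z. poly (laguerre n) (of_real (\<nu> * (cmod z)\<^sup>2)) ^ 2 *
    of_real (exp (- \<nu> * (cmod z)\<^sup>2))) (of_real (pi / \<nu>))"
proof -
  have "(\<lambda>t. poly (laguerre n) (of_real t) ^ 2 * of_real (exp (- t))) \<in> borel_measurable borel"
    by (intro borel_measurable_continuous_onI continuous_intros)
  from has_bochner_integral_radial[OF \<nu> this has_bochner_integral_laguerre_square]
  show ?thesis by simp
qed

lemma laguerre_in_eigen_space:
  assumes \<nu>: "\<nu> > 0"
  shows "(\<lambda>z. poly (laguerre n) (of_real \<nu> * (z * cnj z))) \<in> eigen_space \<nu> n"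
proof -
  have eq: "of_real \<nu> * (z * cnj z) = of_real (\<nu> * (cmod z)\<^sup>2)" for z
    by (simp flip: complex_norm_square)
  \<comment> \<open>The coefficients are real, so at real arguments the complex square is the
    squared modulus, and the normalisation integral also yields square integrability.\<close>
  have re: "poly (laguerre n) (of_real t) ^ 2 = of_real ((cmod (poly (laguerre n) (of_real t)))\<^sup>2)" for t
    unfolding complex_norm_square by (simp add: cnj_poly_laguerre power2_eq_square)
  have "integrable lborel (\<lambda>z. complex_of_real
      ((cmod (poly (laguerre n) (of_real \<nu> * (z * cnj z))))\<^sup>2 * exp (- \<nu> * (cmod z)\<^sup>2)))"
    using has_bochner_integral_laguerre_radial[OF \<nu>, of n]
    unfolding has_bochner_integral_iff re eq by simp
  then have "integrable lborel
      (\<lambda>z. (cmod (poly (laguerre n) (of_real \<nu> * (z * cnj z))))\<^sup>2 * exp (- \<nu> * (cmod z)\<^sup>2))"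
    by (subst (asm) complex_of_real_integrable_eq)
  then show ?thesis
    by (simp add: eigen_space_def smooth_poly_radial magnetic_laplacian_laguerre)
qed

text \<open>Averaging over circles replaces \<open>F\<close> by \<open>F 0\<close> times the
  Laguerre polynomial. What remains is the normalisation integral, equal to
  \<open>pi / \<nu>\<close>; the factor \<open>2 * pi\<close> from the averaging cancels.\<close>

lemma eigen_space_value_at_0:
  assumes F: "F \<in> eigen_space \<nu> n" and \<nu>: "\<nu> > 0"
  shows "(\<integral>z. F z * (poly (laguerre n) (of_real \<nu> * (z * cnj z)) * of_real (exp (- \<nu> * (cmod z)\<^sup>2))) \<partial>lborel) =
    of_real (pi / \<nu>) * F 0"
proof -
  let ?L = "\<lambda>z. poly (laguerre n) (of_real (\<nu> * (cmod z)\<^sup>2))"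
  define \<phi> where "\<phi> z = ?L z * of_real (exp (- \<nu> * (cmod z)\<^sup>2))" for z
  have eq: "poly (laguerre n) (of_real \<nu> * (z * cnj z)) * of_real (exp (- \<nu> * (cmod z)\<^sup>2)) = \<phi> z" for z
    by (simp add: \<phi>_def flip: complex_norm_square)
  have sF: "smooth F" and eig: "\<And>z. magnetic_laplacian \<nu> F z = of_real (real n * \<nu>) * F z"
    using F by (auto simp: eigen_space_def)
  have mean: "integral {0..2 * pi} (\<lambda>t. F (z * cis t)) = of_real (2 * pi) * F 0 * ?L z" for z
  proof -
    \<comment> \<open>At the origin \<open>sgn\<close> is 0, which is not unimodular, so the
      direction defaults to 1.\<close>
    define u where "u = (if z = 0 then 1 else sgn z)"
    have "cmod u = 1" "of_real (cmod z) * u = z"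
      by (auto simp: u_def sgn_eq norm_divide)
    then show ?thesis
      using circle_mean_eigenfunction[OF sF eig \<nu>, of u "cmod z"] by simp
  qed
  have "of_real (2 * pi) * (\<integral>z. F z * \<phi> z \<partial>lborel) =
      (\<integral>z. integral {0..2 * pi} (\<lambda>t. F (z * cis t)) * \<phi> z \<partial>lborel)"
  proof (rule integral_circle_average[symmetric])
    show "continuous_on UNIV \<phi>" unfolding \<phi>_def by (intro continuous_intros)
    show "\<phi> (c * z) = \<phi> z" if "cmod c = 1" for c z using that by (simp add: \<phi>_def norm_mult)
    show "integrable lborel (\<lambda>z. F z * \<phi> z)"
      using eigen_space_integrable_product[OF F laguerre_in_eigen_space[OF \<nu>, of n]] by (simp only: eq)
  qed (rule smooth_continuous[OF sF])
  also have "\<dots> = (\<integral>z. of_real (2 * pi) * F 0 * (?L z ^ 2 * of_real (exp (- \<nu> * (cmod z)\<^sup>2))) \<partial>lborel)"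
    unfolding mean \<phi>_def by (simp add: power2_eq_square mult_ac)
  also have "\<dots> = of_real (2 * pi) * F 0 * of_real (pi / \<nu>)"
    using has_bochner_integral_laguerre_radial[OF \<nu>, of n]
    by (simp add: has_bochner_integral_iff)
  also have "\<dots> = of_real (2 * pi) * (of_real (pi / \<nu>) * F 0)"
    by (simp only: mult_ac)
  finally show ?thesis
    unfolding eq by (subst (asm) mult_cancel_left) simp
qed

lemma gaussian_eq_exp: "complex_of_real (exp (- \<nu> * (cmod z)\<^sup>2)) = exp (- of_real \<nu> * (z * cnj z))"
proof -
  have "complex_of_real (- \<nu> * (cmod z)\<^sup>2) = - of_real \<nu> * (z * cnj z)"
    by (simp only: of_real_mult of_real_minus complex_norm_square)
  then show ?thesis by (metis exp_of_real)
qed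

text \<open>Substituting \<open>z + w\<close> for \<open>z\<close> turns the integral into the one
  at the origin for the magnetic translate of \<open>F\<close>, whose value at 0 is
  \<open>F w\<close>.\<close>

lemma eigen_space_reproducing:
  assumes F: "F \<in> eigen_space \<nu> n" and \<nu>: "\<nu> > 0"
  shows "(\<integral>z. F z * cnj (poly (laguerre n) (of_real \<nu> * ((z - w) * cnj (z - w))) * exp (of_real \<nu> * cnj w * z)) *
    of_real (exp (- \<nu> * (cmod z)\<^sup>2)) \<partial>lborel) = of_real (pi / \<nu>) * F w"
proof -
  define h where "h z = F z * cnj (poly (laguerre n) (of_real \<nu> * ((z - w) * cnj (z - w))) *
    exp (of_real \<nu> * cnj w * z)) * of_real (exp (- \<nu> * (cmod z)\<^sup>2))" for z
  have "continuous_on UNIV F" using F by (auto simp: eigen_space_def intro: smooth_continuous)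
  then have "continuous_on UNIV h" unfolding h_def by (intro continuous_intros)
  then have "(\<integral>z. h z \<partial>lborel) = (\<integral>z. h (z + w) \<partial>lborel)"
    by (intro lborel_integral_shift(2)[symmetric] borel_measurable_continuous_onI)
  also have "(\<lambda>z. h (z + w)) = (\<lambda>z. F (z + w) * exp (- of_real \<nu> * cnj w * z) *
      (poly (laguerre n) (of_real \<nu> * (z * cnj z)) * of_real (exp (- \<nu> * (cmod z)\<^sup>2))))"
  proof
    fix z
    \<comment> \<open>The conjugated exponential cancels the terms \<open>w * cnj z\<close> and
      \<open>w * cnj w\<close> of the shifted Gaussian; the surviving mixed term is the factor of
      the magnetic translation.\<close>
    have e: "cnj (exp (of_real \<nu> * cnj w * (z + w))) * of_real (exp (- \<nu> * (cmod (z + w))\<^sup>2)) =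
        exp (- of_real \<nu> * cnj w * z) * of_real (exp (- \<nu> * (cmod z)\<^sup>2))"
      unfolding gaussian_eq_exp exp_cnj exp_add[symmetric] by (simp add: algebra_simps)
    have "h (z + w) = F (z + w) * poly (laguerre n) (of_real \<nu> * (z * cnj z)) *
        (cnj (exp (of_real \<nu> * cnj w * (z + w))) * of_real (exp (- \<nu> * (cmod (z + w))\<^sup>2)))"
      unfolding h_def complex_cnj_mult cnj_poly_laguerre by (simp add: mult_ac)
    then show "h (z + w) = F (z + w) * exp (- of_real \<nu> * cnj w * z) *
      (poly (laguerre n) (of_real \<nu> * (z * cnj z)) * of_real (exp (- \<nu> * (cmod z)\<^sup>2)))"
      unfolding e by (simp only: mult_ac)
  qed
  also have "(\<integral>z. F (z + w) * exp (- of_real \<nu> * cnj w * z) *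
      (poly (laguerre n) (of_real \<nu> * (z * cnj z)) * of_real (exp (- \<nu> * (cmod z)\<^sup>2))) \<partial>lborel) =
      of_real (pi / \<nu>) * F w"
    using eigen_space_value_at_0[OF eigen_space_translation[OF F] \<nu>, of w] by simp
  finally show ?thesis unfolding h_def .
qed

subsection \<open>Complex Hermite polynomials on the diagonal\<close>

lemma has_wirtinger_gaussian:
  "has_wirtinger (\<lambda>u. of_real (exp (- \<nu> * (cmod u)\<^sup>2)))
    (- of_real \<nu> * cnj u * of_real (exp (- \<nu> * (cmod u)\<^sup>2)))
    (- of_real \<nu> * u * of_real (exp (- \<nu> * (cmod u)\<^sup>2))) u"
proof -
  have "has_wirtinger (\<lambda>u. - of_real \<nu> * (u * cnj u)) (- of_real \<nu> * cnj u) (- of_real \<nu> * u) u"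
    by (rule has_wirtinger_eq_rhs[OF has_wirtinger_mult[OF has_wirtinger_const
            has_wirtinger_mult[OF has_wirtinger_ident has_wirtinger_cnj]]]) simp_all
  from has_wirtinger_comp[OF this DERIV_exp] show ?thesis
    unfolding gaussian_eq_exp by (simp add: mult_ac)
qed

lemma has_wirtinger_sum:
  assumes "\<And>i. i \<in> A \<Longrightarrow> has_wirtinger (F i) (a i) (b i) z"
  shows "has_wirtinger (\<lambda>z. \<Sum>i\<in>A. F i z) (\<Sum>i\<in>A. a i) (\<Sum>i\<in>A. b i) z"
  using assms
  by (induction A rule: infinite_finite_induct) (auto intro: has_wirtinger_add has_wirtinger_const)

lemma has_wirtinger_power:
  assumes "has_wirtinger F a b z"
  shows "has_wirtinger (\<lambda>z. F z ^ k) (of_nat k * F z ^ (k - 1) * a) (of_nat k * F z ^ (k - 1) * b) z"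
proof -
  have "((\<lambda>x. x ^ k) has_field_derivative of_nat k * F z ^ (k - 1)) (at (F z))"
    by (auto intro!: derivative_eq_intros)
  from has_wirtinger_comp[OF assms this] show ?thesis .
qed

text \<open>The factors produced are antiholomorphic, so \<open>wirtinger\<close> acts on the
  Gaussian alone.\<close>

lemma wirtinger_funpow_gaussian:
  "(wirtinger ^^ n) (\<lambda>u. of_real (exp (- \<nu> * (cmod u)\<^sup>2))) =
    (\<lambda>u. (- of_real \<nu> * cnj u) ^ n * of_real (exp (- \<nu> * (cmod u)\<^sup>2)))"
proof (induction n)
  case (Suc n)
  have "has_wirtinger (\<lambda>u. - of_real \<nu> * cnj u) 0 (- of_real \<nu>) u" for u
    by (rule has_wirtinger_eq_rhs[OF has_wirtinger_mult[OF has_wirtinger_const has_wirtinger_cnj]])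
      simp_all
  from has_wirtinger_imp(1)[OF has_wirtinger_mult[OF has_wirtinger_power[OF this] has_wirtinger_gaussian]]
  show ?case unfolding funpow.simps o_apply Suc by (simp add: fun_eq_iff mult_ac)
qed simp

text \<open>Leibniz's rule: \<open>j\<close> of the derivatives fall on the power of
  \<open>cnj u\<close>, and each of the other \<open>m - j\<close> brings the holomorphic factor
  \<open>- \<nu> u\<close> out of the Gaussian. The bound \<open>m \<le> n\<close> lets factorial
  quotients express the falling factorials.\<close>

lemma wirtinger_bar_funpow_gaussian:
  fixes \<nu> :: real and c :: complex
  defines "E \<equiv> \<lambda>u. complex_of_real (exp (- \<nu> * (cmod u)\<^sup>2))"
  assumes "m \<le> n"
  shows "(wirtinger_bar ^^ m) (\<lambda>u. c * cnj u ^ n * E u) =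
    (\<lambda>u. (\<Sum>j\<le>m. of_nat (m choose j) *
      (c * fact n / fact (n - j) * (cnj u ^ (n - j) * (- of_real \<nu> * u) ^ (m - j)))) * E u)"
  using assms(2)
proof (induction m)
  case (Suc m)
  define g where "g m j u = c * fact n / fact (n - j) * (cnj u ^ (n - j) * (- of_real \<nu> * u) ^ (m - j))"
    for m j u
  \<comment> \<open>Differentiating one Leibniz term gives its neighbours with indices
    \<open>Suc j\<close> and \<open>j\<close> at the next order; Pascal's rule then recombines the
    sums.\<close>
  have dg: "has_wirtinger (\<lambda>u. g m j u * E u)
      (wirtinger (\<lambda>u. g m j u * E u) u) ((g (Suc m) (Suc j) u + g (Suc m) j u) * E u) u"
    if "j \<le> m" for j u
  proof -
    define k where "k = c * fact n / fact (n - j)"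
    have "n - j = Suc (n - Suc j)" using that Suc.prems by simp
    then have k: "k * of_nat (n - j) = c * fact n / fact (n - Suc j)"
      unfolding k_def by (simp add: divide_simps del: of_nat_Suc)
    have "has_wirtinger (\<lambda>u. - of_real \<nu> * u) (- of_real \<nu>) 0 u"
      by (rule has_wirtinger_eq_rhs[OF has_wirtinger_mult[OF has_wirtinger_const has_wirtinger_ident]])
        simp_all
    note D = has_wirtinger_mult[OF has_wirtinger_mult[OF has_wirtinger_const[of k]
        has_wirtinger_mult[OF has_wirtinger_power[OF has_wirtinger_cnj, of "n - j"]
            has_wirtinger_power[OF this, of "m - j"]]] has_wirtinger_gaussian[of \<nu>]]
    \<comment> \<open>Only the second coefficient is wanted. The first is left existential and then
      identified with the \<open>wirtinger\<close> derivative by uniqueness.\<close>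
    have "\<exists>a. has_wirtinger (\<lambda>u. g m j u * E u) a ((g (Suc m) (Suc j) u + g (Suc m) j u) * E u) u"
      unfolding g_def E_def k[symmetric] k_def[symmetric]
      by (rule exI, rule has_wirtinger_eq_rhs[OF D refl])
        (simp add: Suc_diff_le[OF that] algebra_simps)
    then show ?thesis
      using has_wirtinger_imp(1) by metis
  qed
  have "wirtinger_bar (\<lambda>u. (\<Sum>j\<le>m. of_nat (m choose j) * g m j u) * E u) u =
      (\<Sum>j\<le>Suc m. of_nat (Suc m choose j) * g (Suc m) j u) * E u" for u
  proof -
    have "(\<lambda>u. (\<Sum>j\<le>m. of_nat (m choose j) * g m j u) * E u) =
        (\<lambda>u. \<Sum>j\<le>m. of_nat (m choose j) * (g m j u * E u))"
      by (simp add: sum_distrib_right mult.assoc)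
    then have "wirtinger_bar (\<lambda>u. (\<Sum>j\<le>m. of_nat (m choose j) * g m j u) * E u) u =
        (\<Sum>j\<le>m. 0 * (g m j u * E u) + of_nat (m choose j) * ((g (Suc m) (Suc j) u + g (Suc m) j u) * E u))"
      using has_wirtinger_imp(2)[OF has_wirtinger_sum[of "{..m}", OF has_wirtinger_mult[OF has_wirtinger_const dg]]]
      by simp
    also have "\<dots> = ((\<Sum>j\<le>m. of_nat (m choose j) * g (Suc m) j u) +
        (\<Sum>j\<le>m. of_nat (m choose j) * g (Suc m) (Suc j) u)) * E u"
      by (simp add: sum_distrib_right sum_distrib_left sum.distrib algebra_simps)
    finally show ?thesis unfolding binomial_sum_Suc .
  qed
  moreover have "(wirtinger_bar ^^ m) (\<lambda>u. c * cnj u ^ n * E u) =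
      (\<lambda>u. (\<Sum>j\<le>m. of_nat (m choose j) * g m j u) * E u)"
    using Suc by (simp add: g_def)
  ultimately have "(wirtinger_bar ^^ Suc m) (\<lambda>u. c * cnj u ^ n * E u) =
      (\<lambda>u. (\<Sum>j\<le>Suc m. of_nat (Suc m choose j) * g (Suc m) j u) * E u)"
    by (simp only: funpow.simps o_apply) blast
  then show ?case unfolding g_def .
qed simp

lemma complex_hermite_diagonal:
  "complex_hermite \<nu> n n z =
    (- of_real \<nu>) ^ n * fact n * poly (laguerre n) (of_real \<nu> * (z * cnj z))"
proof -
  let ?E = "\<lambda>u. complex_of_real (exp (- \<nu> * (cmod u)\<^sup>2))"
  let ?x = "of_real \<nu> * (z * cnj z)" and ?c = "(- complex_of_real \<nu>) ^ n"
  have E: "of_real (exp (\<nu> * (cmod z)\<^sup>2)) * ?E z = 1"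
    by (simp flip: of_real_mult exp_add)
  have "(\<Sum>j\<le>n. of_nat (n choose j) * (?c * fact n / fact (n - j) * (cnj z ^ (n - j) * (- of_real \<nu> * z) ^ (n - j)))) =
      (\<Sum>k\<le>n. ?c * fact n * ((-1) ^ k * of_nat (n choose k) / fact k * ?x ^ k))"
    \<comment> \<open>The new index \<open>k = n - j\<close> counts the derivatives that hit the
      Gaussian; they produce the k-th power of \<open>- ?x\<close>.\<close>
    by (rule sum.reindex_bij_witness[of _ "\<lambda>k. n - k" "\<lambda>k. n - k"])
      (auto simp: binomial_symmetric[symmetric] power_mult_distrib power_minus[of "of_real \<nu> * z"])
  also have "\<dots> = ?c * fact n * poly (laguerre n) ?x"
    by (simp only: poly_laguerre sum_distrib_left)
  finally show ?thesis
    unfolding complex_hermite_def wirtinger_funpow_gaussian power_mult_distrib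
      wirtinger_bar_funpow_gaussian[OF order_refl]
    using E by (simp add: mult_ac)
qed

subsection \<open>The reproducing kernel\<close>

text \<open>Each kernel function is evaluated by the other kernel: \<open>K z w\<close> is the
  product of \<open>K\<close> at \<open>w\<close> with \<open>K'\<close> at \<open>z\<close>, which
  the reproducing property of \<open>K\<close> and then that of \<open>K'\<close> carry over to
  \<open>K' z w\<close>. This lets the theorem characterise the kernel by an equivalence.\<close>

lemma reproducing_kernel_unique:
  assumes herm: "\<And>f g. ip g f = cnj (ip f g)"
    and K: "is_reproducing_kernel H ip K" and K': "is_reproducing_kernel H ip K'"
  shows "K = K'"
proof (intro ext)
  fix z w
  note mem = K[unfolded is_reproducing_kernel_def, THEN conjunct1, rule_format]
    K'[unfolded is_reproducing_kernel_def, THEN conjunct1, rule_format]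
  note rep = K[unfolded is_reproducing_kernel_def, THEN conjunct2, rule_format]
    K'[unfolded is_reproducing_kernel_def, THEN conjunct2, rule_format]
  have "K z w = ip (\<lambda>u. K u w) (\<lambda>u. K' u z)"
    by (rule rep(2)[OF mem(1)])
  also have "\<dots> = cnj (ip (\<lambda>u. K' u z) (\<lambda>u. K u w))"
    by (rule herm)
  also have "ip (\<lambda>u. K' u z) (\<lambda>u. K u w) = K' w z"
    by (rule rep(1)[OF mem(2), symmetric])
  also have "K' w z = ip (\<lambda>u. K' u z) (\<lambda>u. K' u w)"
    by (rule rep(2)[OF mem(2)])
  also have "cnj (ip (\<lambda>u. K' u z) (\<lambda>u. K' u w)) = ip (\<lambda>u. K' u w) (\<lambda>u. K' u z)"
    by (rule herm[symmetric])
  also have "\<dots> = K' z w"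
    by (rule rep(2)[OF mem(2), symmetric])
  finally show "K z w = K' z w" .
qed

lemma cnj_weight: "cnj (weight s z) = weight s z"
  by (simp add: weight_def exp_cnj add.commute)

lemma weighted_inner_hermitian: "weighted_inner s g f = cnj (weighted_inner s f g)"
  unfolding weighted_inner_def
  by (subst Bochner_Integration.integral_cnj[symmetric]) (simp only: complex_cnj_mult cnj_weight complex_cnj_cnj mult_ac)

text \<open>The squared modulus of the twisting factor cancels the \<open>alpha\<close> part of the
  weight, so the twist is an isometry from the Gaussian space.\<close>

lemma weighted_inner_twist:
  "weighted_inner s (\<lambda>z. exp (- of_real (alpha s) * z\<^sup>2) * F z) (\<lambda>z. exp (- of_real (alpha s) * z\<^sup>2) * G z) =
    (\<integral>z. F z * cnj (G z) * of_real (exp (- nu s * (cmod z)\<^sup>2)) \<partial>lborel)"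
proof -
  have weight: "exp (- of_real (alpha s) * z\<^sup>2) * cnj (exp (- of_real (alpha s) * z\<^sup>2)) * weight s z =
      of_real (exp (- nu s * (cmod z)\<^sup>2))" for z
    unfolding weight_def exp_cnj exp_of_real[symmetric] exp_add[symmetric]
    by (simp add: algebra_simps)
  have "a * F z * cnj (a * G z) * v = a * cnj a * v * (F z * cnj (G z))" for a v z
    by (simp add: mult_ac)
  then have "exp (- of_real (alpha s) * z\<^sup>2) * F z * cnj (exp (- of_real (alpha s) * z\<^sup>2) * G z) * weight s z =
      F z * cnj (G z) * of_real (exp (- nu s * (cmod z)\<^sup>2))" for z
    by (simp only: weight mult.commute[of "of_real _"])
  then show ?thesis unfolding weighted_inner_def by (simp only:)
qed

theorem theorem3p4:
  fixes s :: real and n :: nat and K :: "complex \<Rightarrow> complex \<Rightarrow> complex"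
  assumes "0 < s" and "s < 1"
  shows "is_reproducing_kernel (X_space n s) (weighted_inner s) K \<longleftrightarrow>
    (\<forall>z w. K z w =
       of_real ((1 - s\<^sup>2) / (2 * pi * s)) * ((-1) ^ n / (fact n * of_real (nu s) ^ n)) *
       exp (of_real (nu s) * z * cnj w - of_real (alpha s) * (z\<^sup>2 + (cnj w)\<^sup>2)) *
       complex_hermite (nu s) n n (z - w))"
proof -
  define \<nu> where "\<nu> = nu s"
  define a where "a = complex_of_real (alpha s)"
  have \<nu>: "\<nu> > 0"
    using assms by (simp add: \<nu>_def nu_def power_less_one_iff abs_square_less_1)
  define G where "G w z = poly (laguerre n) (of_real \<nu> * ((z - w) * cnj (z - w))) * exp (of_real \<nu> * cnj w * z)"
    for w z
  \<comment> \<open>The constant inverts the \<open>pi / \<nu>\<close> of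
    \<open>eigen_space_reproducing\<close>. The conjugate of the exponential is the twisting factor
    at \<open>w\<close>, which converts \<open>F w\<close> into \<open>f w\<close>.\<close>
  define c where "c w = of_real (\<nu> / pi) * exp (- a * (cnj w)\<^sup>2)" for w
  define K0 where "K0 z w = exp (- a * z\<^sup>2) * (c w * G w z)" for z w
  have G: "(\<lambda>z. c w * G w z) \<in> eigen_space \<nu> n" for w
    \<comment> \<open>Translation by \<open>- w\<close> moves the centre of the Laguerre function to
      \<open>w\<close> and makes the exponent of the accompanying factor positive.\<close>
    using eigen_space_cmult[OF eigen_space_translation[OF laguerre_in_eigen_space[OF \<nu>], of n "- w"]]
    by (simp add: G_def)
  have K0: "is_reproducing_kernel (X_space n s) (weighted_inner s) K0"
    unfolding is_reproducing_kernel_def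
  proof (intro conjI allI ballI)
    show "(\<lambda>z. K0 z w) \<in> X_space n s" for w
      using G[of w] by (auto simp: X_space_def K0_def a_def \<nu>_def)
    fix f w assume "f \<in> X_space n s"
    then obtain F where F: "F \<in> eigen_space \<nu> n" and f: "f = (\<lambda>z. exp (- a * z\<^sup>2) * F z)"
      by (auto simp: X_space_def a_def \<nu>_def)
    have "weighted_inner s f (\<lambda>z. K0 z w) =
        (\<integral>z. F z * cnj (c w * G w z) * of_real (exp (- \<nu> * (cmod z)\<^sup>2)) \<partial>lborel)"
      unfolding f K0_def a_def \<nu>_def by (rule weighted_inner_twist)
    also have "\<dots> = (\<integral>z. cnj (c w) * (F z * cnj (G w z) * of_real (exp (- \<nu> * (cmod z)\<^sup>2))) \<partial>lborel)"
      by (simp add: mult_ac)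
    also have "\<dots> = cnj (c w) * (of_real (pi / \<nu>) * F w)"
      using eigen_space_reproducing[OF F \<nu>, of w] unfolding G_def by (simp only: integral_mult_right_zero)
    also have "\<dots> = f w"
      using \<nu> by (simp add: c_def f exp_cnj a_def)
    finally show "f w = weighted_inner s f (\<lambda>z. K0 z w)" ..
  qed
  have "K0 z w = of_real ((1 - s\<^sup>2) / (2 * pi * s)) * ((-1) ^ n / (fact n * of_real (nu s) ^ n)) *
       exp (of_real (nu s) * z * cnj w - of_real (alpha s) * (z\<^sup>2 + (cnj w)\<^sup>2)) *
       complex_hermite (nu s) n n (z - w)" for z w
  proof -
    let ?H = "poly (laguerre n) (of_real \<nu> * ((z - w) * cnj (z - w)))"
    have 1: "(1 - s\<^sup>2) / (2 * pi * s) = \<nu> / pi"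
      by (simp add: \<nu>_def nu_def)
    \<comment> \<open>The prefactor of the kernel is exactly the reciprocal of the constant in
      \<open>complex_hermite_diagonal\<close>.\<close>
    have 2: "(-1) ^ n / (fact n * of_real \<nu> ^ n) * ((- of_real \<nu>) ^ n * fact n) = (1::complex)"
    proof -
      have "(-1) ^ n * (-1) ^ n = (1::complex)" by (simp flip: power_mult_distrib)
      with \<nu> show ?thesis unfolding power_minus[of "complex_of_real \<nu>"] by simp
    qed
    have 3: "exp (of_real \<nu> * z * cnj w - a * (z\<^sup>2 + (cnj w)\<^sup>2)) =
        exp (- a * z\<^sup>2) * exp (- a * (cnj w)\<^sup>2) * exp (of_real \<nu> * cnj w * z)"
      unfolding exp_add[symmetric] by (simp add: algebra_simps)
    have "of_real (\<nu> / pi) * ((-1) ^ n / (fact n * of_real \<nu> ^ n)) *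
        (exp (- a * z\<^sup>2) * exp (- a * (cnj w)\<^sup>2) * exp (of_real \<nu> * cnj w * z)) *
        ((- of_real \<nu>) ^ n * fact n * ?H) =
        of_real (\<nu> / pi) * ((-1) ^ n / (fact n * of_real \<nu> ^ n) * ((- of_real \<nu>) ^ n * fact n)) *
        (exp (- a * z\<^sup>2) * exp (- a * (cnj w)\<^sup>2) * exp (of_real \<nu> * cnj w * z)) * ?H"
      by (simp only: mult_ac)
    also have "\<dots> = K0 z w"
      unfolding 2 K0_def c_def G_def by (simp only: mult_ac mult_1_left)
    finally show ?thesis
      unfolding 1 complex_hermite_diagonal \<nu>_def[symmetric] a_def[symmetric] 3 by (rule sym)
  qed
  then have "(\<forall>z w. K z w = of_real ((1 - s\<^sup>2) / (2 * pi * s)) * ((-1) ^ n / (fact n * of_real (nu s) ^ n)) *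
       exp (of_real (nu s) * z * cnj w - of_real (alpha s) * (z\<^sup>2 + (cnj w)\<^sup>2)) *
       complex_hermite (nu s) n n (z - w)) \<longleftrightarrow> K = K0"
    by (simp only: fun_eq_iff)
  \<comment> \<open>Both sides of the claim are now equivalent to \<open>K = K0\<close>: the formula
    by the computation above, the kernel property by uniqueness.\<close>
  moreover have "is_reproducing_kernel (X_space n s) (weighted_inner s) K \<longleftrightarrow> K = K0"
  proof
    assume "is_reproducing_kernel (X_space n s) (weighted_inner s) K"
    then show "K = K0" by (rule reproducing_kernel_unique[OF weighted_inner_hermitian _ K0])
  next
    assume "K = K0"
    with K0 show "is_reproducing_kernel (X_space n s) (weighted_inner s) K" by (simp only:)
  qed
  ultimately show ?thesis by (simp only:)
qed

end
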